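(* Let $X$ be a finite metric space and let $\mathrm{BMH}_\ast(X)$ denote its blurred magnitude homology. Suppose that, for each $k\ge 0$, the bars of the barcode of $\mathrm{BMH}_k(X)$ are $[a_{k,1},b_{k,1}),\ldots,[a_{k,m_k},b_{k,m_k})$. Then, for all sufficiently large $t$, the magnitude of $tX$ is given by $$|tX| = \sum_{k=0}^\infty\sum_{i=1}^{m_k}(-1)^k\bigl(e^{-a_{k,i}t}-e^{-b_{k,i}t}\bigr).$$
   Context: Magnitude: for a finite metric space $(X,d)$, a weighting is a function $w\colon X\to\mathbb{R}$ with $\sum_{y\in X}e^{-d(x,y)}w(y)=1$ for every $x\in X$. If a weighting exists, the magnitude is $|X|=\sum_{x\in X}w(x)$ (independent of the choice of weighting); otherwise it is undefined. For $t>0$, $tX$ is the set $X$ with metric $d_{tX}(x,y)=t\,d_X(x,y)$. Persistence modules: fix a field $\Bbbk$. A persistence module is a functor $M\colon(\mathbb{R},\le)\to\mathbf{Vect}_\Bbbk$. The interval module $\Bbbk[a,b)$ ($-\infty<a<b\le\infty$) is $\Bbbk$ at points of $[a,b)$ and $0$ elsewhere, with identity structure maps between points of $[a,b)$. If $M\cong\bigoplus_i\Bbbk[a_i,b_i)$, the multiset of intervals $[a_i,b_i)$ is the barcode of $M$, and these intervals are its bars. Convention: $e^{-\infty}=0$. Blurred magnitude homology: put $\ell(x_0,\ldots,x_k)=d(x_0,x_1)+\cdots+d(x_{k-1},x_k)$. The blurred magnitude chain complex $\mathrm{BMC}_\ast(X)$ is the chain complex of persistence modules in which $\mathrm{BMC}_k(X)(l)$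 is the $\Bbbk$-vector space with basis the tuples $(x_0,\ldots,x_k)\in X^{k+1}$ such that $x_{i}\ne x_{i+1}$ for all $i$ and $\ell(x_0,\ldots,x_k)\le l$; structure maps are the inclusions, and the boundary operator is $\partial_k(x_0,\ldots,x_k)=\sum_{i=0}^k(-1)^i(x_0,\ldots,\widehat{x_i},\ldots,x_k)$ for $k\ge1$, where tuples with two equal consecutive entries are interpreted as $0$. Then $\mathrm{BMH}_k(X)=H_k(\mathrm{BMC}_\ast(X))$. *)

theory Defs
  imports
    "HOL-Analysis.Abstract_Metric_Spaces"
    "HOL-Library.Extended_Real"
    "HOL-Algebra.AbelCoset"
    "Jordan_Normal_Form.Missing_VectorSpace"
begin

section \<open>Magnitude of finite metric spaces\<close>

definition weighting :: "'a set \<Rightarrow> ('a \<Rightarrow> 'a \<Rightarrow> real) \<Rightarrow> ('a \<Rightarrow> real) \<Rightarrow> bool" where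
  "weighting X d w \<longleftrightarrow> (\<forall>x\<in>X. (\<Sum>y\<in>X. exp (- d x y) * w y) = 1)"

definition has_magnitude :: "'a set \<Rightarrow> ('a \<Rightarrow> 'a \<Rightarrow> real) \<Rightarrow> bool" where
  "has_magnitude X d \<longleftrightarrow> (\<exists>w. weighting X d w)"

text \<open>Only meaningful under \<^term>\<open>has_magnitude X d\<close>; the value does not depend on the choice of
  weighting because \<^term>\<open>d\<close> is symmetric.\<close>

definition magnitude :: "'a set \<Rightarrow> ('a \<Rightarrow> 'a \<Rightarrow> real) \<Rightarrow> real" where
  "magnitude X d = (THE m. \<exists>w. weighting X d w \<and> m = (\<Sum>x\<in>X. w x))"

definition scale_metric :: "real \<Rightarrow> ('a \<Rightarrow> 'a \<Rightarrow> real) \<Rightarrow> 'a \<Rightarrow> 'a \<Rightarrow> real" where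
  "scale_metric t d = (\<lambda>x y. t * d x y)"


section \<open>Persistence modules\<close>

text \<open>\<open>space_at M l\<close> is the vector space at \<^term>\<open>l::real\<close>, and \<open>smap M l l'\<close> the structure map
  from \<open>l\<close> to \<open>l'\<close>, which is only relevant for \<open>l \<le> l'\<close>.\<close>

record ('c, 'v) pers_mod =
  space_at :: "real \<Rightarrow> ('c, 'v) module"
  smap :: "real \<Rightarrow> real \<Rightarrow> 'v \<Rightarrow> 'v"

locale persistence_module =
  fixes K :: "('c, 'r) ring_scheme" and M :: "('c, 'v) pers_mod"
  assumes vectorspace_at: "vectorspace K (space_at M l)"
    and smap_hom: "l \<le> l' \<Longrightarrow> smap M l l' \<in> module_hom K (space_at M l) (space_at M l')"
    and smap_id: "v \<in> carrier (space_at M l) \<Longrightarrow> smap M l l v = v"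
    and smap_comp: "\<lbrakk>l \<le> l'; l' \<le> l''; v \<in> carrier (space_at M l)\<rbrakk>
          \<Longrightarrow> smap M l' l'' (smap M l l' v) = smap M l l'' v"

definition pers_iso ::
  "('c, 'r) ring_scheme \<Rightarrow> ('c, 'v) pers_mod \<Rightarrow> ('c, 'w) pers_mod \<Rightarrow> bool" where
  "pers_iso K M N \<longleftrightarrow> (\<exists>\<phi>.
     (\<forall>l. \<phi> l \<in> module_hom K (space_at M l) (space_at N l) \<and>
          bij_betw (\<phi> l) (carrier (space_at M l)) (carrier (space_at N l))) \<and>
     (\<forall>l l'. l \<le> l' \<longrightarrow> (\<forall>v\<in>carrier (space_at M l). \<phi> l' (smap M l l' v) = smap N l l' (\<phi> l v))))"

text \<open>In the module records below, the fields \<open>mult\<close> and \<open>one\<close> (inherited from rings) play no role.\<close>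

definition interval_module :: "('c, 'r) ring_scheme \<Rightarrow> real \<Rightarrow> ereal \<Rightarrow> ('c, 'c) pers_mod" where
  "interval_module K a b =
    (let alive = (\<lambda>l. a \<le> l \<and> ereal l < b) in
     \<lparr>space_at = (\<lambda>l.
        \<lparr>carrier = (if alive l then carrier K else {\<zero>\<^bsub>K\<^esub>}),
         mult = (\<lambda>_ _. \<zero>\<^bsub>K\<^esub>), one = \<zero>\<^bsub>K\<^esub>,
         zero = \<zero>\<^bsub>K\<^esub>, add = add K, smult = monoid.mult K\<rparr>),
      smap = (\<lambda>l l' v. if alive l \<and> alive l' then v else \<zero>\<^bsub>K\<^esub>)\<rparr>)"

lemma persistence_module_interval:
  assumes "field K"
  shows "persistence_module K (interval_module K a b)"
proof -
  interpret field K by fact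
  have c: "cring K" by (rule is_cring)
  have "module K (space_at (interval_module K a b) l)" for l
    apply (intro moduleI abelian_groupI c)
    apply (auto simp: interval_module_def Let_def a_ac m_assoc l_distr r_distr split: if_splits)
    done
  then show ?thesis
    using assms
    apply (intro persistence_module.intro)
    subgoal by (auto simp: vectorspace_def)
    subgoal by (auto simp: module_hom_def interval_module_def Let_def)
    subgoal by (auto simp: interval_module_def Let_def split: if_splits)
    subgoal for l l' l'' by (auto simp: interval_module_def Let_def split: if_splits)
        (metis ereal_less_eq(3) le_less_trans)+
    done
qed

definition module_direct_sum ::
  "'i set \<Rightarrow> ('i \<Rightarrow> ('c, 'v) module) \<Rightarrow> ('c, 'i \<Rightarrow> 'v) module" where
  "module_direct_sum I V =
    \<lparr>carrier = {x \<in> \<Pi>\<^sub>E i\<in>I. carrier (V i). finite {i \<in> I. x i \<noteq> \<zero>\<^bsub>V i\<^esub>}},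
     mult = (\<lambda>_ _. \<lambda>i\<in>I. \<zero>\<^bsub>V i\<^esub>), one = (\<lambda>i\<in>I. \<zero>\<^bsub>V i\<^esub>),
     zero = (\<lambda>i\<in>I. \<zero>\<^bsub>V i\<^esub>), add = (\<lambda>x y. \<lambda>i\<in>I. x i \<oplus>\<^bsub>V i\<^esub> y i),
     smult = (\<lambda>c x. \<lambda>i\<in>I. c \<odot>\<^bsub>V i\<^esub> x i)\<rparr>"

definition pers_direct_sum ::
  "'i set \<Rightarrow> ('i \<Rightarrow> ('c, 'v) pers_mod) \<Rightarrow> ('c, 'i \<Rightarrow> 'v) pers_mod" where
  "pers_direct_sum I M =
    \<lparr>space_at = (\<lambda>l. module_direct_sum I (\<lambda>i. space_at (M i) l)),
     smap = (\<lambda>l l' x. \<lambda>i\<in>I. smap (M i) l l' (x i))\<rparr>"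

text \<open>The barcode is given as an indexed family, so that multiplicities are accounted for:
  the bars are the intervals \<open>[a i, b i)\<close> with \<^term>\<open>i \<in> I\<close>, where \<open>b i\<close> may be infinite.\<close>

definition has_barcode ::
  "('c, 'r) ring_scheme \<Rightarrow> ('c, 'v) pers_mod \<Rightarrow> 'i set \<Rightarrow> ('i \<Rightarrow> real) \<Rightarrow> ('i \<Rightarrow> ereal) \<Rightarrow> bool" where
  "has_barcode K M I a b \<longleftrightarrow>
     (\<forall>i\<in>I. ereal (a i) < b i) \<and>
     pers_iso K M (pers_direct_sum I (\<lambda>i. interval_module K (a i) (b i)))"

text \<open>Convention: \<open>exp (-\<infinity>) = 0\<close>; the value at \<open>\<infinity>\<close> is irrelevant.\<close>

definition exp_ereal :: "ereal \<Rightarrow> real" where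
  "exp_ereal x = (if x = -\<infinity> then 0 else exp (real_of_ereal x))"


section \<open>Homology of chain complexes of persistence modules\<close>

definition quotient_module :: "('c, 'v) module \<Rightarrow> 'v set \<Rightarrow> ('c, 'v set) module" where
  "quotient_module V N =
    \<lparr>carrier = a_rcosets\<^bsub>V\<^esub> N, mult = (\<lambda>_ _. N), one = N,
     zero = N, add = (<+>\<^bsub>V\<^esub>),
     smult = (\<lambda>c A. \<Union>v\<in>A. N +>\<^bsub>V\<^esub> (c \<odot>\<^bsub>V\<^esub> v))\<rparr>"

text \<open>For a complex with chain modules \<open>C k\<close> and boundary \<open>D k l\<close> from \<open>C k\<close> to \<open>C (k - 1)\<close> at the
  parameter \<open>l\<close>; in degree 0 the boundary is the zero map, whatever \<open>D 0\<close> is.  Scalars and structure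
  maps act on a coset through its representatives, which all yield the same coset.\<close>

definition cycles ::
  "(nat \<Rightarrow> ('c, 'v) pers_mod) \<Rightarrow> (nat \<Rightarrow> real \<Rightarrow> 'v \<Rightarrow> 'v) \<Rightarrow> nat \<Rightarrow> real \<Rightarrow> 'v set" where
  "cycles C D k l = {v \<in> carrier (space_at (C k) l).
     k = 0 \<or> D k l v = \<zero>\<^bsub>space_at (C (k - 1)) l\<^esub>}"

definition boundaries ::
  "(nat \<Rightarrow> ('c, 'v) pers_mod) \<Rightarrow> (nat \<Rightarrow> real \<Rightarrow> 'v \<Rightarrow> 'v) \<Rightarrow> nat \<Rightarrow> real \<Rightarrow> 'v set" where
  "boundaries C D k l = D (Suc k) l ` carrier (space_at (C (Suc k)) l)"

definition homology ::
  "(nat \<Rightarrow> ('c, 'v) pers_mod) \<Rightarrow> (nat \<Rightarrow> real \<Rightarrow> 'v \<Rightarrow> 'v) \<Rightarrow> nat \<Rightarrow> ('c, 'v set) pers_mod" where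
  "homology C D k =
    \<lparr>space_at = (\<lambda>l. quotient_module ((space_at (C k) l)\<lparr>carrier := cycles C D k l\<rparr>)
                       (boundaries C D k l)),
     smap = (\<lambda>l l' A. \<Union>v\<in>A. boundaries C D k l' +>\<^bsub>space_at (C k) l'\<^esub> smap (C k) l l' v)\<rparr>"


section \<open>Blurred magnitude homology\<close>

definition tuple_length :: "('a \<Rightarrow> 'a \<Rightarrow> real) \<Rightarrow> 'a list \<Rightarrow> real" where
  "tuple_length d xs = (\<Sum>i<length xs - 1. d (xs ! i) (xs ! Suc i))"

definition bmc_generators :: "'a set \<Rightarrow> ('a \<Rightarrow> 'a \<Rightarrow> real) \<Rightarrow> nat \<Rightarrow> real \<Rightarrow> 'a list set" where
  "bmc_generators X d k l =
    {xs. length xs = Suc k \<and> set xs \<subseteq> X \<and> distinct_adj xs \<and> tuple_length d xs \<le> l}"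

text \<open>Vectors are finitely supported coefficient functions on all of \<^typ>\<open>'s\<close> vanishing off \<^term>\<open>S\<close>,
  so that an inclusion of bases induces a literal inclusion of free vector spaces.\<close>

definition free_module :: "('c, 'r) ring_scheme \<Rightarrow> 's set \<Rightarrow> ('c, 's \<Rightarrow> 'c) module" where
  "free_module K S =
    \<lparr>carrier = {c. range c \<subseteq> carrier K \<and> {s. c s \<noteq> \<zero>\<^bsub>K\<^esub>} \<subseteq> S \<and> finite {s. c s \<noteq> \<zero>\<^bsub>K\<^esub>}},
     mult = (\<lambda>_ _ _. \<zero>\<^bsub>K\<^esub>), one = (\<lambda>_. \<zero>\<^bsub>K\<^esub>),
     zero = (\<lambda>_. \<zero>\<^bsub>K\<^esub>), add = (\<lambda>c c' s. c s \<oplus>\<^bsub>K\<^esub> c' s),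
     smult = (\<lambda>r c s. r \<otimes>\<^bsub>K\<^esub> c s)\<rparr>"

definition BMC ::
  "('c, 'r) ring_scheme \<Rightarrow> 'a set \<Rightarrow> ('a \<Rightarrow> 'a \<Rightarrow> real) \<Rightarrow> nat \<Rightarrow> ('c, 'a list \<Rightarrow> 'c) pers_mod" where
  "BMC K X d k =
    \<lparr>space_at = (\<lambda>l. free_module K (bmc_generators X d k l)), smap = (\<lambda>l l' c. c)\<rparr>"

definition face :: "nat \<Rightarrow> 'a list \<Rightarrow> 'a list" where
  "face i xs = take i xs @ drop (Suc i) xs"

text \<open>The vector represented by a tuple: a basis vector, or 0 if two consecutive entries agree.\<close>

definition tuple_chain :: "('c, 'r) ring_scheme \<Rightarrow> 'a list \<Rightarrow> 'a list \<Rightarrow> 'c" where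
  "tuple_chain K xs = (\<lambda>ys. if distinct_adj xs \<and> ys = xs then \<one>\<^bsub>K\<^esub> else \<zero>\<^bsub>K\<^esub>)"

text \<open>The linear extension of \<open>xs \<mapsto> \<Sum>i\<le>k. (-1)^i (face i xs)\<close>, evaluated at the tuple \<open>ys\<close>.\<close>

definition bmc_boundary ::
  "('c, 'r) ring_scheme \<Rightarrow> nat \<Rightarrow> real \<Rightarrow> ('a list \<Rightarrow> 'c) \<Rightarrow> ('a list \<Rightarrow> 'c)" where
  "bmc_boundary K k l c = (\<lambda>ys.
     \<Oplus>\<^bsub>K\<^esub>xs\<in>{xs. c xs \<noteq> \<zero>\<^bsub>K\<^esub>}. c xs \<otimes>\<^bsub>K\<^esub>
       (\<Oplus>\<^bsub>K\<^esub>i\<in>{..k}. ((\<ominus>\<^bsub>K\<^esub> \<one>\<^bsub>K\<^esub>) [^]\<^bsub>K\<^esub> i) \<otimes>\<^bsub>K\<^esub> tuple_chain K (face i xs) ys))"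

definition BMH ::
  "('c, 'r) ring_scheme \<Rightarrow> 'a set \<Rightarrow> ('a \<Rightarrow> 'a \<Rightarrow> real) \<Rightarrow> nat \<Rightarrow> ('c, ('a list \<Rightarrow> 'c) set) pers_mod" where
  "BMH K X d = homology (BMC K X d) (bmc_boundary K)"

end

theory Submission
  imports Defs "HOL-Analysis.Henstock_Kurzweil_Integration"
begin

text \<open>A bar \<open>[a, b)\<close> contributes \<open>exp (- a t) - exp (- b t) = t \<cdot> \<integral> exp (- t l) dl\<close>, the integral being
  taken over the bar, so only the dimensions of the spaces \<open>BMH k\<close> at each parameter \<open>l\<close> matter: the
  structure maps play no role.  By rank-nullity the alternating sums up to degree \<open>n\<close> of the
  dimensions of homology and of chains differ by at most the rank of the boundary into degree \<open>n\<close>,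
  hence by at most the number of \<open>n\<close>-chain generators.  Integrating against \<open>t exp (- t l)\<close>, the
  partial sums of the claimed series differ from those of \<open>\<Sum>k. (-1)^k T k\<close> by at most \<open>T n\<close>, where \<open>T k\<close>
  is the sum of \<open>exp (- t \<ell>(x))\<close> over all nondegenerate tuples \<open>x\<close> of degree \<open>k\<close>.  For large \<open>t\<close> the
  matrix \<open>exp (- t d(x, y))\<close> is so close to the identity that its inverse is a Neumann series; this
  yields a weighting, shows \<open>|tX| = \<Sum>k. (-1)^k T k\<close>, and makes \<open>T n\<close> tend to 0.\<close>

section \<open>Dimensions of free modules and of quotients\<close>

text \<open>Independence in \<open>U\<close> is independence in \<open>V\<close>, so independent
  subsets of \<open>U\<close> have at most \<open>dim\<close> elements. A maximal one therefore
  exists, and it is a basis of \<open>U\<close>.\<close>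

lemma (in vectorspace) subspace_fin_dim:
  assumes "fin_dim" and U: "subspace K U V"
  shows "vectorspace.fin_dim K (vs U)"
proof -
  interpret U: vectorspace K "vs U"
    using U by (rule subspace_is_vs)
  have sub: "submodule K U V"
    using U by simp
  then have UV: "U \<subseteq> carrier V"
    by (rule submodule.subset)
  have "\<exists>A. finite A \<and> maximal A (\<lambda>S. S \<subseteq> carrier (vs U) \<and> U.lin_indpt S)"
  proof (rule maximal_exists)
    show "{} \<subseteq> carrier (vs U) \<and> U.lin_indpt {}"
      unfolding U.lin_dep_def by auto
    show "finite A \<and> card A \<le> dim" if "A \<subseteq> carrier (vs U) \<and> U.lin_indpt A" for A
      using that assms(1) li_le_dim UV span_li_not_depend(2)[OF _ sub] by auto
  qed
  then obtain A where A: "finite A" "U.basis A"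
    using U.max_li_is_basis by auto
  then show ?thesis
    unfolding U.basis_def U.fin_dim_def by auto
qed

lemma module_hom_comp:
  "f \<in> module_hom R L M \<Longrightarrow> g \<in> module_hom R M N \<Longrightarrow> g \<circ> f \<in> module_hom R L N"
  unfolding module_hom_def by (simp add: Pi_iff)

section \<open>Quotient modules by submodules\<close>

lemma submodule_imp_abelian_subgroup:
  assumes "submodule R N M"
  shows "abelian_subgroup N M"
proof -
  interpret submodule R N M by fact
  interpret module R M by (rule module)
  have "\<ominus>\<^bsub>M\<^esub> x \<in> N" if "x \<in> N" for x
    using that subset submodule.smult_closed[OF assms, of "\<ominus>\<^bsub>R\<^esub> \<one>\<^bsub>R\<^esub>" x] smult_minus_1[of x]
      by (auto simp: subsetD)
  moreover have "N \<noteq> {}"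
    using submodule.zero_closed[OF assms] by blast
  ultimately show ?thesis
    by (intro abelian_subgroupI3 additive_subgroup.intro M.add.subgroupI M.abelian_group_axioms)
       (use subset submodule.m_closed[OF assms] in auto)
qed

text \<open>Additivity is the rule for sums of cosets. Scalar multiplication is encoded as a union
  over representatives, so it must be checked that all representatives of a coset give the same
  result.\<close>

lemma coset_map_module_hom:
  assumes "submodule R N M"
  shows "(\<lambda>v. N +>\<^bsub>M\<^esub> v) \<in> module_hom R M (quotient_module M N)"
proof -
  interpret submodule R N M by fact
  interpret module R M by (rule module)
  interpret abelian_subgroup N M
    using assms by (rule submodule_imp_abelian_subgroup)
  have "(\<Union>v'\<in>N +>\<^bsub>M\<^esub> v. N +>\<^bsub>M\<^esub> (r \<odot>\<^bsub>M\<^esub> v')) = N +>\<^bsub>M\<^esub> (r \<odot>\<^bsub>M\<^esub> v)"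
    if "r \<in> carrier R" "v \<in> carrier M" for r v
  proof -
    have "N +>\<^bsub>M\<^esub> (r \<odot>\<^bsub>M\<^esub> v') = N +>\<^bsub>M\<^esub> (r \<odot>\<^bsub>M\<^esub> v)" if v': "v' \<in> N +>\<^bsub>M\<^esub> v" for v'
    proof -
      obtain n where n: "n \<in> N" "v' = n \<oplus>\<^bsub>M\<^esub> v"
        using v' unfolding a_r_coset_def' by auto
      have "r \<odot>\<^bsub>M\<^esub> v' \<in> N +>\<^bsub>M\<^esub> (r \<odot>\<^bsub>M\<^esub> v)"
        using n that \<open>r \<in> carrier R\<close> \<open>v \<in> carrier M\<close> subset unfolding a_r_coset_def'
        by (auto simp: smult_r_distr subsetD)
      then show ?thesis
        using \<open>r \<in> carrier R\<close> \<open>v \<in> carrier M\<close> a_repr_independence a_subgroup by simp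
    qed
    then have "(\<Union>v'\<in>N +>\<^bsub>M\<^esub> v. N +>\<^bsub>M\<^esub> (r \<odot>\<^bsub>M\<^esub> v')) = (\<Union>v'\<in>N +>\<^bsub>M\<^esub> v. N +>\<^bsub>M\<^esub> (r \<odot>\<^bsub>M\<^esub> v))"
      by (rule SUP_cong[OF refl])
    \<comment> \<open>The union collapses to a single coset only over a nonempty index set, and
      \<open>v\<close> represents its own coset.\<close>
    moreover have "v \<in> N +>\<^bsub>M\<^esub> v"
      using that by (simp add: a_rcos_self)
    ultimately show ?thesis
      using UN_constant[of "N +>\<^bsub>M\<^esub> (r \<odot>\<^bsub>M\<^esub> v)" "N +>\<^bsub>M\<^esub> v"] by (metis empty_iff)
  qed
  note smult = this
  show ?thesis
    unfolding module_hom_def mem_Collect_eq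
  proof (intro conjI allI impI funcsetI; (elim conjE)?)
    fix v w
    assume "v \<in> carrier M" "w \<in> carrier M"
    then show "N +>\<^bsub>M\<^esub> (v \<oplus>\<^bsub>M\<^esub> w) = (N +>\<^bsub>M\<^esub> v) \<oplus>\<^bsub>quotient_module M N\<^esub> (N +>\<^bsub>M\<^esub> w)"
      unfolding quotient_module_def by (simp only: a_rcos_sum ring_record_simps)
  next
    fix r v
    assume "r \<in> carrier R" "v \<in> carrier M"
    then show "N +>\<^bsub>M\<^esub> (r \<odot>\<^bsub>M\<^esub> v) = r \<odot>\<^bsub>quotient_module M N\<^esub> (N +>\<^bsub>M\<^esub> v)"
      unfolding quotient_module_def by (simp only: smult module.simps)
  next
    fix v
    assume "v \<in> carrier M"
    then show "N +>\<^bsub>M\<^esub> v \<in> carrier (quotient_module M N)"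
      unfolding quotient_module_def by (simp add: a_rcosetsI[OF a_subset])
  qed
qed

section \<open>Free modules and their dimension\<close>

lemma carrier_free_module:
  "c \<in> carrier (free_module K S) \<longleftrightarrow>
    (\<forall>s. c s \<in> carrier K) \<and> (\<forall>s. s \<notin> S \<longrightarrow> c s = \<zero>\<^bsub>K\<^esub>) \<and> finite {s. c s \<noteq> \<zero>\<^bsub>K\<^esub>}"
  unfolding free_module_def by auto

lemma carrier_free_moduleI:
  assumes "finite S" "\<And>s. c s \<in> carrier K" "\<And>s. s \<notin> S \<Longrightarrow> c s = \<zero>\<^bsub>K\<^esub>"
  shows "c \<in> carrier (free_module K S)"
  unfolding carrier_free_module using assms finite_subset[of "{s. c s \<noteq> \<zero>\<^bsub>K\<^esub>}" S] by auto

lemma free_module_simps [simp]: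
  "\<zero>\<^bsub>free_module K S\<^esub> = (\<lambda>_. \<zero>\<^bsub>K\<^esub>)"
  "c \<oplus>\<^bsub>free_module K S\<^esub> c' = (\<lambda>s. c s \<oplus>\<^bsub>K\<^esub> c' s)"
  "r \<odot>\<^bsub>free_module K S\<^esub> c = (\<lambda>s. r \<otimes>\<^bsub>K\<^esub> c s)"
  by (simp_all add: free_module_def)

lemma free_module_vectorspace:
  assumes "field K"
  shows "vectorspace K (free_module K S)"
proof -
  interpret field K by fact
  \<comment> \<open>Pointwise operations that send zeros to zero keep supports finite. An
    \<open>f\<close> that ignores an argument covers negation and scalar multiples.\<close>
  have fin: "finite {s. f (c s) (c' s) \<noteq> \<zero>\<^bsub>K\<^esub>}"
    if "finite {s. c s \<noteq> \<zero>\<^bsub>K\<^esub>}" "finite {s. c' s \<noteq> \<zero>\<^bsub>K\<^esub>}" "f \<zero>\<^bsub>K\<^esub> \<zero>\<^bsub>K\<^esub> = \<zero>\<^bsub>K\<^esub>"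
    for f :: "'a \<Rightarrow> 'a \<Rightarrow> 'a" and c c' :: "'c \<Rightarrow> 'a"
    by (rule finite_subset[of _ "{s. c s \<noteq> \<zero>\<^bsub>K\<^esub>} \<union> {s. c' s \<noteq> \<zero>\<^bsub>K\<^esub>}"]) (use that in auto)
  have "\<exists>c'\<in>carrier (free_module K S). (\<lambda>s. c s \<oplus>\<^bsub>K\<^esub> c' s) = (\<lambda>_. \<zero>\<^bsub>K\<^esub>)"
    if "c \<in> carrier (free_module K S)" for c
    by (rule bexI[of _ "\<lambda>s. \<ominus>\<^bsub>K\<^esub> c s"])
       (use that fin[of c c "\<lambda>x y. \<ominus>\<^bsub>K\<^esub> x"] in \<open>auto simp: carrier_free_module r_neg\<close>)
  then have "module K (free_module K S)"
    by (intro module_criteria is_cring)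
       (auto simp: carrier_free_module a_ac m_assoc l_distr r_distr
             intro: fin[of _ _ "add K"] fin[of _ _ "\<lambda>x y. _ \<otimes>\<^bsub>K\<^esub> x"])
  then show ?thesis
    using assms by (simp add: vectorspace_def)
qed

lemma finsum_free_module:
  assumes "field K" "finite A" "f \<in> A \<rightarrow> carrier (free_module K S)"
  shows "(\<Oplus>\<^bsub>free_module K S\<^esub>a\<in>A. f a) = (\<lambda>s. \<Oplus>\<^bsub>K\<^esub>a\<in>A. f a s)"
proof -
  interpret field K by fact
  interpret V: vectorspace K "free_module K S"
    using assms(1) by (rule free_module_vectorspace)
  show ?thesis
    using assms(2,3)
  proof (induction A rule: finite_induct)
    case (insert a A)
    then have "f a s \<in> carrier K" "(\<lambda>a. f a s) \<in> A \<rightarrow> carrier K" for s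
      by (auto simp: carrier_free_module Pi_def)
    with insert show ?case
      by (simp add: Pi_def)
  qed simp
qed

text \<open>The indicator functions \<open>\<delta> s\<close> form a basis: evaluating a linear
  combination at \<open>s\<close> returns the coefficient of \<open>\<delta> s\<close>, which gives
  both independence and spanning.\<close>

lemma free_module_dim:
  assumes "field K" and fin: "finite S"
  shows "vectorspace.fin_dim K (free_module K S)"
    and "vectorspace.dim K (free_module K S) = card S"
proof -
  interpret field K by fact
  interpret V: vectorspace K "free_module K S"
    using assms(1) by (rule free_module_vectorspace)
  define \<delta> where "\<delta> s = (\<lambda>s'. if s' = s then \<one>\<^bsub>K\<^esub> else \<zero>\<^bsub>K\<^esub>)" for s :: 'c
  have inj: "inj_on \<delta> T" for T
    by (rule inj_onI) (metis \<delta>_def zero_not_one)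
  have \<delta>: "\<delta> ` S \<subseteq> carrier (free_module K S)"
    by (auto simp: carrier_free_module \<delta>_def)
  have lc: "V.lincomb a (\<delta> ` S) = (\<lambda>s. if s \<in> S then a (\<delta> s) else \<zero>\<^bsub>K\<^esub>)"
    if a: "a \<in> \<delta> ` S \<rightarrow> carrier K" for a
  proof -
    have a\<delta>: "a (\<delta> s) \<in> carrier K" if "s \<in> S" for s
      using a that by auto
    have "V.lincomb a (\<delta> ` S) = (\<Oplus>\<^bsub>free_module K S\<^esub>s\<in>S. a (\<delta> s) \<odot>\<^bsub>free_module K S\<^esub> \<delta> s)"
      unfolding V.lincomb_def
    proof (rule V.finsum_reindex[OF _ inj])
      show "(\<lambda>v. a v \<odot>\<^bsub>free_module K S\<^esub> v) \<in> \<delta> ` S \<rightarrow> carrier (free_module K S)"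
        using a \<delta> by (intro funcsetI V.smult_closed) auto
    qed
    also have "\<dots> = (\<lambda>s'. \<Oplus>\<^bsub>K\<^esub>s\<in>S. (a (\<delta> s) \<odot>\<^bsub>free_module K S\<^esub> \<delta> s) s')"
    proof (intro finsum_free_module assms funcsetI)
      show "a (\<delta> s) \<odot>\<^bsub>free_module K S\<^esub> \<delta> s \<in> carrier (free_module K S)" if "s \<in> S" for s
        using a \<delta> that by (intro V.smult_closed) auto
    qed
    also have "\<dots> = (\<lambda>s'. \<Oplus>\<^bsub>K\<^esub>s\<in>S. if s' = s then a (\<delta> s) else \<zero>\<^bsub>K\<^esub>)"
      using a\<delta> by (intro ext finsum_cong') (auto simp: \<delta>_def[of _, THEN fun_cong])
    also have "\<dots> = (\<lambda>s. if s \<in> S then a (\<delta> s) else \<zero>\<^bsub>K\<^esub>)"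
    proof
      fix s'
      show "(\<Oplus>\<^bsub>K\<^esub>s\<in>S. if s' = s then a (\<delta> s) else \<zero>\<^bsub>K\<^esub>) = (if s' \<in> S then a (\<delta> s') else \<zero>\<^bsub>K\<^esub>)"
      proof (cases "s' \<in> S")
        case True
        then show ?thesis
          using add.finprod_singleton[of s' S "\<lambda>s. a (\<delta> s)"] fin a\<delta> by auto
      next
        case False
        then show ?thesis
          by (auto intro!: add.finprod_one_eqI)
      qed
    qed
    finally show ?thesis .
  qed
  have "V.basis (\<delta> ` S)"
    unfolding V.basis_def
  proof (intro conjI \<delta>)
    show "V.lin_indpt (\<delta> ` S)"
    proof (rule V.finite_lin_indpt2)
      fix a
      assume "a \<in> \<delta> ` S \<rightarrow> carrier K" "V.lincomb a (\<delta> ` S) = \<zero>\<^bsub>free_module K S\<^esub>"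
      then show "\<forall>v\<in>\<delta> ` S. a v = \<zero>\<^bsub>K\<^esub>"
        by (auto simp: lc dest: fun_cong split: if_splits)
    qed (use fin \<delta> in auto)
    show "V.gen_set (\<delta> ` S)"
    proof
      show "V.span (\<delta> ` S) \<subseteq> carrier (free_module K S)"
        using \<delta> by (rule V.span_is_subset2)
      show "carrier (free_module K S) \<subseteq> V.span (\<delta> ` S)"
      proof
        fix c
        assume c: "c \<in> carrier (free_module K S)"
        \<comment> \<open>Coefficients of \<open>V.lincomb\<close> are indexed by vectors, so the
          values of \<open>c\<close> are reached through the inverse of
          \<open>\<delta>\<close>.\<close>
        have "V.lincomb (\<lambda>v. c (the_inv_into S \<delta> v)) (\<delta> ` S) = c"
          using c by (subst lc) (auto simp: carrier_free_module the_inv_into_f_f[OF inj])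
        moreover have "(\<lambda>v. c (the_inv_into S \<delta> v)) \<in> \<delta> ` S \<rightarrow> carrier K"
          using c by (auto simp: carrier_free_module)
        ultimately show "c \<in> V.span (\<delta> ` S)"
          using V.finite_span[OF _ \<delta>] fin by auto
      qed
    qed
  qed
  then show "V.fin_dim" "V.dim = card S"
    using fin V.dim_basis[of "\<delta> ` S"] card_image[OF inj, of S]
    unfolding V.fin_dim_def V.basis_def by auto
qed

section \<open>Rank-nullity and the dimension of a quotient\<close>

lemma vectorspace_rank_nullity:
  assumes "vectorspace K V" "vectorspace.fin_dim K V" "vectorspace K W" "T \<in> module_hom K V W"
  shows "vectorspace.dim K (W\<lparr>carrier := T ` carrier V\<rparr>)
    + vectorspace.dim K (V\<lparr>carrier := {v \<in> carrier V. T v = \<zero>\<^bsub>W\<^esub>}\<rparr>) = vectorspace.dim K V"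
proof -
  interpret V: vectorspace K V by fact
  interpret W: vectorspace K W by fact
  interpret linear_map K V W T
    by (intro linear_map.intro mod_hom.intro mod_hom_axioms.intro assms)
       (rule V.module_axioms W.module_axioms)+
  show ?thesis
    using rank_nullity[OF assms(2)] unfolding im_def ker_def by simp
qed

text \<open>Rank-nullity is applied to the composite of the coset map with \<open>\<phi>\<close>, a
  linear map from \<open>V\<close> onto \<open>W\<close> whose kernel is \<open>N\<close>. Stating
  the result as a sum avoids subtraction of natural numbers.\<close>

lemma quotient_dim:
  assumes V: "vectorspace K V" "vectorspace.fin_dim K V" and N: "submodule K N V" and W: "vectorspace K W"
    and \<phi>: "\<phi> \<in> module_hom K (quotient_module V N) W"
    and bij: "bij_betw \<phi> (carrier (quotient_module V N)) (carrier W)"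
  shows "vectorspace.dim K W + vectorspace.dim K (V\<lparr>carrier := N\<rparr>) = vectorspace.dim K V"
proof -
  interpret V: vectorspace K V by fact
  interpret W: vectorspace K W by fact
  interpret abelian_subgroup N V
    using N by (rule submodule_imp_abelian_subgroup)
  have NV: "N \<subseteq> carrier V"
    using N by (rule submodule.subset)
  have quot: "carrier (quotient_module V N) = (\<lambda>v. N +>\<^bsub>V\<^esub> v) ` carrier V"
    unfolding quotient_module_def A_RCOSETS_def' by auto
  define F where "F = \<phi> \<circ> (\<lambda>v. N +>\<^bsub>V\<^esub> v)"
  have F: "F \<in> module_hom K V W"
    unfolding F_def using coset_map_module_hom[OF N] \<phi> by (rule module_hom_comp)
  interpret linear_map K V W F
    by (intro linear_map.intro mod_hom.intro mod_hom_axioms.intro assms F)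
       (rule V.module_axioms W.module_axioms)+
  have "F ` carrier V = carrier W"
    using bij unfolding bij_betw_def quot F_def by (simp add: image_comp)
  moreover have "F v = \<zero>\<^bsub>W\<^esub> \<longleftrightarrow> v \<in> N" if v: "v \<in> carrier V" for v
  proof -
    have "F v = \<zero>\<^bsub>W\<^esub> \<longleftrightarrow> \<phi> (N +>\<^bsub>V\<^esub> v) = \<phi> (N +>\<^bsub>V\<^esub> \<zero>\<^bsub>V\<^esub>)"
      using f0_is_0 unfolding F_def by simp
    also have "\<dots> \<longleftrightarrow> N +>\<^bsub>V\<^esub> v = N +>\<^bsub>V\<^esub> \<zero>\<^bsub>V\<^esub>"
      using bij v unfolding bij_betw_def quot by (intro inj_on_eq_iff) auto
    also have "N +>\<^bsub>V\<^esub> \<zero>\<^bsub>V\<^esub> = N"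
      using NV by simp
    also have "N +>\<^bsub>V\<^esub> v = N \<longleftrightarrow> v \<in> N"
      using v a_rcos_self a_subgroup V.a_coset_join2 by metis
    finally show ?thesis .
  qed
  then have "{v \<in> carrier V. F v = \<zero>\<^bsub>W\<^esub>} = N"
    using NV by auto
  ultimately show ?thesis
    using vectorspace_rank_nullity[OF V W F] by simp
qed

section \<open>Dimension at a parameter from the bars alive there\<close>

lemma direct_sum_interval_module:
  fixes a :: "'i \<Rightarrow> real" and b :: "'i \<Rightarrow> ereal" and l :: real
  assumes "field K" and fin: "finite I"
  defines "M \<equiv> space_at (pers_direct_sum I (\<lambda>i. interval_module K (a i) (b i))) l"
    and "J \<equiv> {i \<in> I. a i \<le> l \<and> ereal l < b i}"
  defines "\<psi> \<equiv> \<lambda>x i. if i \<in> J then x i else \<zero>\<^bsub>K\<^esub>"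
  shows "\<psi> \<in> module_hom K M (free_module K J)"
    and "bij_betw \<psi> (carrier M) (carrier (free_module K J))"
proof -
  interpret field K by fact
  have JI: "J \<subseteq> I" and finJ: "finite J"
    using fin by (auto simp: J_def)
  \<comment> \<open>At \<open>l\<close> the summands outside \<open>J\<close> are zero, and
    finiteness of \<open>I\<close> makes finite support automatic.\<close>
  have carrier_M: "carrier M = {x \<in> extensional I. (\<forall>i\<in>J. x i \<in> carrier K) \<and> (\<forall>i\<in>I - J. x i = \<zero>\<^bsub>K\<^esub>)}"
    unfolding M_def pers_direct_sum_def module_direct_sum_def interval_module_def J_def PiE_def Pi_def
    using fin by (auto simp: Let_def split: if_splits)
  have add_M: "x \<oplus>\<^bsub>M\<^esub> y = (\<lambda>i\<in>I. x i \<oplus>\<^bsub>K\<^esub> y i)" and smult_M: "r \<odot>\<^bsub>M\<^esub> x = (\<lambda>i\<in>I. r \<otimes>\<^bsub>K\<^esub> x i)" for x y r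
    unfolding M_def pers_direct_sum_def module_direct_sum_def interval_module_def by (simp_all add: Let_def)
  have supp: "finite {i. (if i \<in> J then x i else \<zero>\<^bsub>K\<^esub>) \<noteq> \<zero>\<^bsub>K\<^esub>}" for x
    by (rule finite_subset[OF _ finJ]) auto
  show "\<psi> \<in> module_hom K M (free_module K J)"
    unfolding module_hom_def mem_Collect_eq
  proof (intro conjI allI impI funcsetI)
    fix x
    assume "x \<in> carrier M"
    then show "\<psi> x \<in> carrier (free_module K J)"
      using JI supp by (auto simp: carrier_M carrier_free_module \<psi>_def)
  next
    fix x y
    show "\<psi> (x \<oplus>\<^bsub>M\<^esub> y) = \<psi> x \<oplus>\<^bsub>free_module K J\<^esub> \<psi> y"
      using JI by (auto simp: add_M \<psi>_def fun_eq_iff)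
  next
    fix r x
    assume "r \<in> carrier K \<and> x \<in> carrier M"
    then show "\<psi> (r \<odot>\<^bsub>M\<^esub> x) = r \<odot>\<^bsub>free_module K J\<^esub> \<psi> x"
      using JI by (auto simp: smult_M \<psi>_def fun_eq_iff)
  qed
  \<comment> \<open>Vectors of the direct sum are \<open>undefined\<close> off \<open>I\<close>,
    those of the free module are zero off \<open>J\<close>. On \<open>I - J\<close> both are zero,
    so restricting to \<open>I\<close> undoes \<open>\<psi>\<close>.\<close>
  show "bij_betw \<psi> (carrier M) (carrier (free_module K J))"
  proof (rule bij_betw_byWitness[where f' = "\<lambda>c. restrict c I"])
    show "\<forall>x\<in>carrier M. restrict (\<psi> x) I = x"
      unfolding carrier_M \<psi>_def by (auto simp: extensional_def fun_eq_iff restrict_def)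
    show "\<forall>c\<in>carrier (free_module K J). \<psi> (restrict c I) = c"
      using JI by (auto simp: carrier_free_module \<psi>_def fun_eq_iff)
    show "\<psi> ` carrier M \<subseteq> carrier (free_module K J)"
      using JI supp by (auto simp: carrier_M carrier_free_module \<psi>_def)
    show "(\<lambda>c. restrict c I) ` carrier (free_module K J) \<subseteq> carrier M"
      using JI by (auto simp: carrier_M carrier_free_module)
  qed
qed

text \<open>The barcode isomorphism at \<open>l\<close>, followed by the identification of the
  direct sum with the free module on the bars alive at \<open>l\<close>, computes the dimension of
  the quotient of \<open>V\<close> by \<open>N\<close>.\<close>

lemma barcode_dim:
  assumes "field K" and fin: "finite I"
    and bar: "has_barcode K M I a b"
    and M: "space_at M l = quotient_module V N"
    and V: "vectorspace K V" "vectorspace.fin_dim K V" and N: "submodule K N V"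
  shows "card {i \<in> I. a i \<le> l \<and> ereal l < b i} + vectorspace.dim K (V\<lparr>carrier := N\<rparr>) = vectorspace.dim K V"
proof -
  define J where "J = {i \<in> I. a i \<le> l \<and> ereal l < b i}"
  have "finite J"
    using fin by (simp add: J_def)
  let ?S = "space_at (pers_direct_sum I (\<lambda>i. interval_module K (a i) (b i))) l"
  obtain \<phi> where \<phi>: "\<phi> \<in> module_hom K (quotient_module V N) ?S"
      "bij_betw \<phi> (carrier (quotient_module V N)) (carrier ?S)"
    using bar unfolding has_barcode_def pers_iso_def M[symmetric] by blast
  let ?\<psi> = "\<lambda>x i. if i \<in> J then x i else \<zero>\<^bsub>K\<^esub>"
  have \<psi>: "?\<psi> \<in> module_hom K ?S (free_module K J)"
      "bij_betw ?\<psi> (carrier ?S) (carrier (free_module K J))"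
    unfolding J_def by (rule direct_sum_interval_module[OF assms(1) fin])+
  have "vectorspace.dim K (free_module K J) + vectorspace.dim K (V\<lparr>carrier := N\<rparr>) = vectorspace.dim K V"
    using V N free_module_vectorspace[OF assms(1)] module_hom_comp[OF \<phi>(1) \<psi>(1)]
      bij_betw_trans[OF \<phi>(2) \<psi>(2)] by (rule quotient_dim)
  then show ?thesis
    using free_module_dim(2)[OF assms(1) \<open>finite J\<close>] by (simp add: J_def)
qed

section \<open>The blurred magnitude complex\<close>

lemma face_0 [simp]: "face 0 xs = tl xs"
  by (cases xs) (simp_all add: face_def)

lemma face_Suc_Cons [simp]: "face (Suc i) (x # xs) = x # face i xs"
  by (simp add: face_def)

lemma face_Nil [simp]: "face i [] = []"
  by (simp add: face_def)

lemma length_face: "i < length xs \<Longrightarrow> length (face i xs) = length xs - 1"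
  by (simp add: face_def)

text \<open>The simplicial identity: once position \<open>i\<close> is deleted, the entry from
  position \<open>Suc j\<close> is at position \<open>j\<close>.\<close>

lemma face_face: "i \<le> j \<Longrightarrow> face j (face i xs) = face i (face (Suc j) xs)"
proof (induction i arbitrary: j xs)
  case 0
  then show ?case by (cases xs) auto
next
  case (Suc i)
  then obtain j' where "j = Suc j'" "i \<le> j'" by (cases j) auto
  with Suc.IH show ?case by (cases xs) auto
qed

lemma set_face: "set (face i xs) \<subseteq> set xs"
  unfolding face_def using set_take_subset set_drop_subset by fastforce

lemma tuple_length_simps [simp]:
  "tuple_length d [] = 0"
  "tuple_length d [x] = 0"
  "tuple_length d (x # y # xs) = d x y + tuple_length d (y # xs)"
  by (simp_all add: tuple_length_def sum.lessThan_Suc_shift del: sum.lessThan_Suc)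

text \<open>Deleting an entry outside the equal pair leaves the pair adjacent. Together with the
  equality of the two faces at the pair, this makes the boundary of a degenerate tuple
  vanish.\<close>

lemma degenerate_face:
  assumes "Suc i < length xs" "xs ! i = xs ! Suc i"
  shows "face i xs = face (Suc i) xs"
    and "j < length xs \<Longrightarrow> j \<noteq> i \<Longrightarrow> j \<noteq> Suc i \<Longrightarrow> \<not> distinct_adj (face j xs)"
proof -
  show "face i xs = face (Suc i) xs"
    using assms by (auto simp: face_def take_Suc_conv_app_nth Cons_nth_drop_Suc)
  assume j: "j < length xs" "j \<noteq> i" "j \<noteq> Suc i"
  have nth: "face j xs ! p = xs ! (if p < j then p else Suc p)" if "Suc p < length xs" for p
    using that j(1) by (auto simp: face_def nth_append)
  have "\<exists>p. Suc p < length (face j xs) \<and> face j xs ! p = face j xs ! Suc p"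
  proof (cases "j < i")
    case True
    \<comment> \<open>Deleting an entry before the pair moves it one place to the left.\<close>
    then show ?thesis
      using assms j by (intro exI[of _ "i - 1"]) (auto simp: length_face nth)
  next
    case False
    then show ?thesis
      using assms j by (intro exI[of _ i]) (auto simp: length_face nth)
  qed
  then show "\<not> distinct_adj (face j xs)"
    unfolding distinct_adj_conv_nth by blast
qed

context Metric_space
begin

text \<open>Deleting an inner entry is the triangle inequality, deleting an end drops a nonnegative
  summand. This is why the boundary respects the parameter \<open>l\<close>.\<close>

lemma tuple_length_face_le:
  "set xs \<subseteq> M \<Longrightarrow> tuple_length d (face i xs) \<le> tuple_length d xs"
proof (induction xs arbitrary: i rule: induct_list012)
  case (2 x)
  then show ?case by (cases i) auto
next
  case (3 x y xs)
  show ?case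
  proof (cases i)
    case (Suc i')
    show ?thesis
    proof (cases i')
      \<comment> \<open>The deleted entry is \<open>y\<close>; if \<open>xs\<close> is nonempty, the
        triangle inequality compares the step from \<open>x\<close> to \<open>hd xs\<close> with the
        detour through \<open>y\<close>.\<close>
      case 0
      then show ?thesis
        using Suc 3 triangle[of x y "hd xs"] by (cases xs) auto
    next
      case (Suc i'')
      then show ?thesis
        using 3(2)[of i'] 3(3) \<open>i = Suc i'\<close> by simp
    qed
  qed simp
qed simp

lemma face_in_bmc_generators:
  assumes "xs \<in> bmc_generators M d (Suc k) l" "i \<le> Suc k" "distinct_adj (face i xs)"
  shows "face i xs \<in> bmc_generators M d k l"
  using assms set_face[of i xs] tuple_length_face_le[of xs i]
  unfolding bmc_generators_def by (auto simp: length_face)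

end

lemma finite_bmc_generators: "finite X \<Longrightarrow> finite (bmc_generators X d k l)"
  by (rule finite_subset[OF _ finite_lists_length_eq[of X "Suc k"]]) (auto simp: bmc_generators_def)

text \<open>The matrix entry of the boundary at the generators \<open>xs\<close> and
  \<open>ys\<close>. In these terms, two successive boundaries compose to a product of
  matrices.\<close>

definition bmc_coeff :: "('c, 'r) ring_scheme \<Rightarrow> nat \<Rightarrow> 'a list \<Rightarrow> 'a list \<Rightarrow> 'c" where
  "bmc_coeff K k xs ys =
    (\<Oplus>\<^bsub>K\<^esub>i\<in>{..k}. ((\<ominus>\<^bsub>K\<^esub> \<one>\<^bsub>K\<^esub>) [^]\<^bsub>K\<^esub> i) \<otimes>\<^bsub>K\<^esub> tuple_chain K (face i xs) ys)"

section \<open>The coefficients of the boundary operator\<close>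

context cring
begin

lemma tuple_chain_closed [simp]: "tuple_chain R xs ys \<in> carrier R"
  by (simp add: tuple_chain_def)

lemma bmc_coeff_closed [simp]: "bmc_coeff R k xs ys \<in> carrier R"
  unfolding bmc_coeff_def by (rule finsum_closed) auto

lemma finsum_swap:
  assumes "finite A" "finite B" "\<And>x y. x \<in> A \<Longrightarrow> y \<in> B \<Longrightarrow> f x y \<in> carrier R"
  shows "(\<Oplus>x\<in>A. \<Oplus>y\<in>B. f x y) = (\<Oplus>y\<in>B. \<Oplus>x\<in>A. f x y)"
  using assms(1,3)
proof (induction A rule: finite_induct)
  case empty
  then show ?case by (simp add: finsum_zero)
next
  case (insert x A)
  have "(\<Oplus>x\<in>insert x A. \<Oplus>y\<in>B. f x y) = (\<Oplus>y\<in>B. f x y) \<oplus> (\<Oplus>x\<in>A. \<Oplus>y\<in>B. f x y)"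
    using insert by (intro finsum_insert) (auto intro!: finsum_closed)
  also have "\<dots> = (\<Oplus>y\<in>B. f x y) \<oplus> (\<Oplus>y\<in>B. \<Oplus>x\<in>A. f x y)"
    using insert by simp
  also have "\<dots> = (\<Oplus>y\<in>B. f x y \<oplus> (\<Oplus>x\<in>A. f x y))"
    using insert by (intro finsum_addf[symmetric]) (auto intro!: finsum_closed)
  also have "\<dots> = (\<Oplus>y\<in>B. \<Oplus>x\<in>insert x A. f x y)"
    using insert by (intro finsum_cong') (auto intro!: finsum_closed finsum_insert[symmetric])
  finally show ?case .
qed

text \<open>\<open>bmc_boundary\<close> sums over the support of \<open>c\<close>, which changes
  with \<open>c\<close>. Summing over a fixed finite set that contains the support makes boundaries
  of different chains comparable.\<close>

lemma bmc_boundary_eq: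
  assumes "c \<in> carrier (free_module R S)" "finite S"
  shows "bmc_boundary R k l c ys = (\<Oplus>xs\<in>S. c xs \<otimes> bmc_coeff R k xs ys)"
proof -
  have "{xs. c xs \<noteq> \<zero>} \<subseteq> S"
    using assms by (auto simp: carrier_free_module)
  then show ?thesis
    unfolding bmc_boundary_def bmc_coeff_def[symmetric]
    using assms by (intro add.finprod_mono_neutral_cong_left) (auto simp: carrier_free_module)
qed

lemma bmc_coeff_eq_0:
  assumes "\<And>i. i \<le> k \<Longrightarrow> distinct_adj ys \<Longrightarrow> ys \<noteq> face i xs"
  shows "bmc_coeff R k xs ys = \<zero>"
  unfolding bmc_coeff_def
  using assms by (intro add.finprod_one_eqI) (auto simp: tuple_chain_def)

text \<open>Only the two faces at the equal neighbours survive; they agree and carry opposite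
  signs.\<close>

lemma bmc_coeff_degenerate:
  assumes len: "length xs = Suc k" and "\<not> distinct_adj xs"
  shows "bmc_coeff R k xs ys = \<zero>"
proof -
  obtain i where i: "Suc i < length xs" "xs ! i = xs ! Suc i"
    using assms unfolding distinct_adj_conv_nth by blast
  let ?s = "\<lambda>i. (\<ominus> \<one>) [^] i \<otimes> tuple_chain R (face i xs) ys"
  have "bmc_coeff R k xs ys = (\<Oplus>j\<in>{i, Suc i}. ?s j)"
    unfolding bmc_coeff_def
  proof (rule add.finprod_mono_neutral_cong_right)
    show "?s j = \<zero>" if "j \<in> {..k} - {i, Suc i}" for j
      using degenerate_face(2)[OF i, of j] that len by (auto simp: tuple_chain_def)
  qed (use i len in auto)
  also have "\<dots> = ?s i \<oplus> ?s (Suc i)"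
    by simp
  also have "\<dots> = \<zero>"
    by (simp add: degenerate_face(1)[OF i, symmetric] l_minus r_minus r_neg m_comm)
  finally show ?thesis .
qed

text \<open>The cancellation behind \<open>\<partial>\<partial> = 0\<close>, isolated from tuples.
  In the step from \<open>n\<close> to \<open>Suc n\<close> the double sum gains the column
  \<open>j = Suc n\<close> and the row \<open>i = Suc (Suc n)\<close>. By the symmetry of
  \<open>g\<close> these have the same entries, and they come with opposite signs.\<close>

lemma simplicial_sum_eq_0:
  assumes "\<And>i j. g i j \<in> carrier R" "\<And>i j. i \<le> j \<Longrightarrow> g i j = g (Suc j) i"
  shows "(\<Oplus>i\<in>{..Suc n}. (\<ominus> \<one>) [^] i \<otimes> (\<Oplus>j\<in>{..n}. (\<ominus> \<one>) [^] j \<otimes> g i j)) = \<zero>"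
proof (induction n)
  case 0
  show ?case
    using assms(1) assms(2)[of 0 0] by (simp add: l_minus r_neg l_neg)
next
  case (Suc n)
  let ?s = "\<lambda>i::nat. (\<ominus> \<one>) [^] i"
  let ?row = "\<lambda>i. \<Oplus>j\<in>{..n}. ?s j \<otimes> g i j"
  let ?last = "\<Oplus>i\<in>{..Suc n}. ?s i \<otimes> g i (Suc n)"
  have cl: "?s i \<in> carrier R" "?row i \<in> carrier R" "?last \<in> carrier R" for i
    using assms(1) by (auto intro!: finsum_closed)
  have "(\<Oplus>i\<in>{..Suc n}. ?s i \<otimes> (\<Oplus>j\<in>{..Suc n}. ?s j \<otimes> g i j))
      = (\<Oplus>i\<in>{..Suc n}. ?s i \<otimes> ?row i \<oplus> ?s (Suc n) \<otimes> (?s i \<otimes> g i (Suc n)))"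
  proof (rule finsum_cong')
    fix i
    have "(\<Oplus>j\<in>{..Suc n}. ?s j \<otimes> g i j) = ?s (Suc n) \<otimes> g i (Suc n) \<oplus> ?row i"
      using assms(1) by (intro finsum_Suc) auto
    then show "?s i \<otimes> (\<Oplus>j\<in>{..Suc n}. ?s j \<otimes> g i j) = ?s i \<otimes> ?row i \<oplus> ?s (Suc n) \<otimes> (?s i \<otimes> g i (Suc n))"
      using assms(1) cl by (simp add: r_distr a_comm m_lcomm del: nat_pow_Suc)
  qed (use assms(1) cl in auto)
  also have "\<dots> = (\<Oplus>i\<in>{..Suc n}. ?s i \<otimes> ?row i) \<oplus> (\<Oplus>i\<in>{..Suc n}. ?s (Suc n) \<otimes> (?s i \<otimes> g i (Suc n)))"
    using assms(1) cl by (intro finsum_addf) auto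
  also have "(\<Oplus>i\<in>{..Suc n}. ?s i \<otimes> ?row i) = \<zero>"
    by (rule Suc.IH)
  also have "(\<Oplus>i\<in>{..Suc n}. ?s (Suc n) \<otimes> (?s i \<otimes> g i (Suc n))) = ?s (Suc n) \<otimes> ?last"
    using assms(1) cl by (intro finsum_rdistr[symmetric]) auto
  finally have 1: "(\<Oplus>i\<in>{..Suc n}. ?s i \<otimes> (\<Oplus>j\<in>{..Suc n}. ?s j \<otimes> g i j)) = ?s (Suc n) \<otimes> ?last"
    using cl by simp
  have 2: "(\<Oplus>j\<in>{..Suc n}. ?s j \<otimes> g (Suc (Suc n)) j) = ?last"
    using assms by (intro finsum_cong') auto
  have "(\<Oplus>i\<in>{..Suc (Suc n)}. ?s i \<otimes> (\<Oplus>j\<in>{..Suc n}. ?s j \<otimes> g i j))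
      = ?s (Suc (Suc n)) \<otimes> (\<Oplus>j\<in>{..Suc n}. ?s j \<otimes> g (Suc (Suc n)) j)
        \<oplus> (\<Oplus>i\<in>{..Suc n}. ?s i \<otimes> (\<Oplus>j\<in>{..Suc n}. ?s j \<otimes> g i j))"
    by (intro finsum_Suc funcsetI m_closed finsum_closed) (use assms(1) in auto)
  also have "\<dots> = ?s (Suc (Suc n)) \<otimes> ?last \<oplus> ?s (Suc n) \<otimes> ?last"
    by (simp only: 1 2)
  also have "\<dots> = \<zero>"
  proof -
    have "?s (Suc (Suc n)) = \<ominus> ?s (Suc n)"
      by (simp add: r_minus)
    then show ?thesis
      using cl by (simp add: l_minus l_neg del: nat_pow_Suc)
  qed
  finally show ?case .
qed

text \<open>A degenerate tuple has boundary 0, so degenerate faces need not be discarded after the first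
  boundary, and the simplicial identities apply.\<close>

lemma bmc_coeff_bmc_coeff:
  assumes S: "finite S" "\<And>i. i \<le> Suc k \<Longrightarrow> distinct_adj (face i xs) \<Longrightarrow> face i xs \<in> S"
    and len: "length xs = Suc (Suc k)"
  shows "(\<Oplus>ys\<in>S. bmc_coeff R (Suc k) xs ys \<otimes> bmc_coeff R k ys zs) = \<zero>"
proof -
  let ?s = "\<lambda>i::nat. (\<ominus> \<one>) [^] i"
  have face: "(\<Oplus>ys\<in>S. tuple_chain R (face i xs) ys \<otimes> bmc_coeff R k ys zs) = bmc_coeff R k (face i xs) zs"
    if i: "i \<le> Suc k" for i
  proof (cases "distinct_adj (face i xs)")
    case True
    have "(\<Oplus>ys\<in>S. tuple_chain R (face i xs) ys \<otimes> bmc_coeff R k ys zs)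
        = (\<Oplus>ys\<in>S. if face i xs = ys then bmc_coeff R k ys zs else \<zero>)"
      by (intro finsum_cong') (auto simp: tuple_chain_def True)
    also have "\<dots> = bmc_coeff R k (face i xs) zs"
      using S(1) S(2)[OF i True] by (intro add.finprod_singleton) auto
    finally show ?thesis .
  next
    case False
    have "bmc_coeff R k (face i xs) zs = \<zero>"
      using False i len by (intro bmc_coeff_degenerate) (auto simp: length_face)
    moreover have "(\<Oplus>ys\<in>S. tuple_chain R (face i xs) ys \<otimes> bmc_coeff R k ys zs) = \<zero>"
      by (intro add.finprod_one_eqI) (auto simp: tuple_chain_def False)
    ultimately show ?thesis by simp
  qed
  have "(\<Oplus>ys\<in>S. bmc_coeff R (Suc k) xs ys \<otimes> bmc_coeff R k ys zs)
      = (\<Oplus>ys\<in>S. \<Oplus>i\<in>{..Suc k}. ?s i \<otimes> tuple_chain R (face i xs) ys \<otimes> bmc_coeff R k ys zs)"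
    unfolding bmc_coeff_def[of _ "Suc k"]
    by (intro finsum_cong' finsum_ldistr) (auto intro!: finsum_closed)
  also have "\<dots> = (\<Oplus>i\<in>{..Suc k}. \<Oplus>ys\<in>S. ?s i \<otimes> tuple_chain R (face i xs) ys \<otimes> bmc_coeff R k ys zs)"
    using S(1) by (intro finsum_swap) auto
  also have "\<dots> = (\<Oplus>i\<in>{..Suc k}. ?s i \<otimes> (\<Oplus>ys\<in>S. tuple_chain R (face i xs) ys \<otimes> bmc_coeff R k ys zs))"
    using S(1) by (intro finsum_cong') (auto intro!: finsum_closed simp: finsum_rdistr m_assoc)
  also have "\<dots> = (\<Oplus>i\<in>{..Suc k}. ?s i \<otimes> bmc_coeff R k (face i xs) zs)"
    by (intro finsum_cong') (auto simp: face)
  \<comment> \<open>Here \<open>g i j\<close> is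
    \<open>tuple_chain R (face j (face i xs)) zs\<close>, so the required symmetry is the simplicial
    identity.\<close>
  also have "\<dots> = \<zero>"
    unfolding bmc_coeff_def by (intro simplicial_sum_eq_0) (auto simp: face_face)
  finally show ?thesis .
qed

end

section \<open>The boundary as a linear map with square zero\<close>

lemma space_at_BMC [simp]: "space_at (BMC K X d k) l = free_module K (bmc_generators X d k l)"
  by (simp add: BMC_def)

text \<open>Nondegenerate faces of generators are generators at the same \<open>l\<close>, so
  coefficients vanish at all other tuples. Linearity is read off from the sum over the fixed set of
  generators.\<close>

lemma bmc_boundary_hom:
  fixes X :: "'a set"
  assumes "field K" "Metric_space X d" "finite X"
  shows "bmc_boundary K (Suc k) l \<in>
    module_hom K (free_module K (bmc_generators X d (Suc k) l)) (free_module K (bmc_generators X d k l))"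
proof -
  interpret field K by fact
  interpret Metric_space X d by fact
  let ?S = "bmc_generators X d (Suc k) l" and ?S' = "bmc_generators X d k l"
  have fin: "finite ?S" "finite ?S'"
    using assms(3) by (simp_all add: finite_bmc_generators)
  show ?thesis
    unfolding module_hom_def mem_Collect_eq
  proof (intro conjI allI impI funcsetI; (elim conjE)?)
    fix c
    assume c: "c \<in> carrier (free_module K ?S)"
    then have cl: "c xs \<in> carrier K" for xs
      by (simp add: carrier_free_module)
    have eq: "bmc_boundary K (Suc k) l c ys = (\<Oplus>\<^bsub>K\<^esub>xs\<in>?S. c xs \<otimes>\<^bsub>K\<^esub> bmc_coeff K (Suc k) xs ys)" for ys
      using c fin(1) by (rule bmc_boundary_eq)
    have "bmc_boundary K (Suc k) l c ys = \<zero>\<^bsub>K\<^esub>" if ys: "ys \<notin> ?S'" for ys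
    proof -
      have "bmc_coeff K (Suc k) xs ys = \<zero>\<^bsub>K\<^esub>" if "xs \<in> ?S" for xs
        using face_in_bmc_generators[OF that] ys by (intro bmc_coeff_eq_0) auto
      then show ?thesis
        unfolding eq using cl by (intro add.finprod_one_eqI) auto
    qed
    moreover have "bmc_boundary K (Suc k) l c ys \<in> carrier K" for ys
      unfolding eq using cl by (intro finsum_closed) auto
    ultimately show "bmc_boundary K (Suc k) l c \<in> carrier (free_module K ?S')"
      by (intro carrier_free_moduleI fin)
  next
    fix c c'
    assume c: "c \<in> carrier (free_module K ?S)" "c' \<in> carrier (free_module K ?S)"
    interpret V: vectorspace K "free_module K ?S"
      using assms(1) by (rule free_module_vectorspace)
    have "c \<oplus>\<^bsub>free_module K ?S\<^esub> c' \<in> carrier (free_module K ?S)"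
      using c by (rule V.add.m_closed)
    note sum = bmc_boundary_eq[OF this fin(1)]
    have cl: "c xs \<in> carrier K" "c' xs \<in> carrier K" for xs
      using c by (auto simp: carrier_free_module)
    show "bmc_boundary K (Suc k) l (c \<oplus>\<^bsub>free_module K ?S\<^esub> c')
        = bmc_boundary K (Suc k) l c \<oplus>\<^bsub>free_module K ?S'\<^esub> bmc_boundary K (Suc k) l c'"
    proof
      fix ys :: "'a list"
      let ?co = "\<lambda>xs. bmc_coeff K (Suc k) xs ys"
      have "(\<Oplus>\<^bsub>K\<^esub>xs\<in>?S. (c xs \<oplus>\<^bsub>K\<^esub> c' xs) \<otimes>\<^bsub>K\<^esub> ?co xs)
          = (\<Oplus>\<^bsub>K\<^esub>xs\<in>?S. c xs \<otimes>\<^bsub>K\<^esub> ?co xs \<oplus>\<^bsub>K\<^esub> c' xs \<otimes>\<^bsub>K\<^esub> ?co xs)"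
        using cl by (intro finsum_cong') (auto simp: l_distr)
      also have "\<dots> = (\<Oplus>\<^bsub>K\<^esub>xs\<in>?S. c xs \<otimes>\<^bsub>K\<^esub> ?co xs) \<oplus>\<^bsub>K\<^esub> (\<Oplus>\<^bsub>K\<^esub>xs\<in>?S. c' xs \<otimes>\<^bsub>K\<^esub> ?co xs)"
        using cl by (intro finsum_addf) auto
      finally show "bmc_boundary K (Suc k) l (c \<oplus>\<^bsub>free_module K ?S\<^esub> c') ys
          = (bmc_boundary K (Suc k) l c \<oplus>\<^bsub>free_module K ?S'\<^esub> bmc_boundary K (Suc k) l c') ys"
        by (simp only: sum[unfolded free_module_simps] bmc_boundary_eq[OF c(1) fin(1)] bmc_boundary_eq[OF c(2) fin(1)] free_module_simps)
    qed
  next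
    fix r c
    assume c: "r \<in> carrier K" "c \<in> carrier (free_module K ?S)"
    interpret V: vectorspace K "free_module K ?S"
      using assms(1) by (rule free_module_vectorspace)
    have "r \<odot>\<^bsub>free_module K ?S\<^esub> c \<in> carrier (free_module K ?S)"
      using c by (rule V.smult_closed)
    note sum = bmc_boundary_eq[OF this fin(1)]
    have cl: "c xs \<in> carrier K" for xs
      using c by (auto simp: carrier_free_module)
    show "bmc_boundary K (Suc k) l (r \<odot>\<^bsub>free_module K ?S\<^esub> c)
        = r \<odot>\<^bsub>free_module K ?S'\<^esub> bmc_boundary K (Suc k) l c"
    proof
      fix ys :: "'a list"
      let ?co = "\<lambda>xs. bmc_coeff K (Suc k) xs ys"
      have "(\<Oplus>\<^bsub>K\<^esub>xs\<in>?S. (r \<otimes>\<^bsub>K\<^esub> c xs) \<otimes>\<^bsub>K\<^esub> ?co xs) = (\<Oplus>\<^bsub>K\<^esub>xs\<in>?S. r \<otimes>\<^bsub>K\<^esub> (c xs \<otimes>\<^bsub>K\<^esub> ?co xs))"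
        using c(1) cl by (intro finsum_cong') (auto simp: m_assoc)
      also have "\<dots> = r \<otimes>\<^bsub>K\<^esub> (\<Oplus>\<^bsub>K\<^esub>xs\<in>?S. c xs \<otimes>\<^bsub>K\<^esub> ?co xs)"
        using c(1) cl fin(1) by (intro finsum_rdistr[symmetric]) auto
      finally show "bmc_boundary K (Suc k) l (r \<odot>\<^bsub>free_module K ?S\<^esub> c) ys
          = (r \<odot>\<^bsub>free_module K ?S'\<^esub> bmc_boundary K (Suc k) l c) ys"
        by (simp only: sum[unfolded free_module_simps] bmc_boundary_eq[OF c(2) fin(1)] free_module_simps)
    qed
  qed
qed

text \<open>Interchanging the sums over \<open>xs\<close> and \<open>ys\<close> leaves, for each
  \<open>xs\<close>, an entry of the product of two consecutive boundary matrices, which is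
  zero.\<close>

lemma bmc_boundary_bmc_boundary:
  assumes "field K" "Metric_space X d" "finite X"
    and c: "c \<in> carrier (free_module K (bmc_generators X d (Suc (Suc k)) l))"
  shows "bmc_boundary K (Suc k) l (bmc_boundary K (Suc (Suc k)) l c) = (\<lambda>_. \<zero>\<^bsub>K\<^esub>)"
proof
  interpret field K by fact
  interpret Metric_space X d by fact
  fix zs
  let ?S = "bmc_generators X d (Suc (Suc k)) l" and ?S' = "bmc_generators X d (Suc k) l"
  let ?D = "bmc_boundary K (Suc (Suc k)) l c"
  let ?co = "\<lambda>k. bmc_coeff K k"
  have fin: "finite ?S" "finite ?S'"
    using assms(3) by (simp_all add: finite_bmc_generators)
  have cl: "c xs \<in> carrier K" for xs
    using c by (simp add: carrier_free_module)
  have D: "?D \<in> carrier (free_module K ?S')"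
    using bmc_boundary_hom[OF assms(1-3), of "Suc k" l] c unfolding module_hom_def by blast
  have "bmc_boundary K (Suc k) l ?D zs = (\<Oplus>\<^bsub>K\<^esub>ys\<in>?S'. ?D ys \<otimes>\<^bsub>K\<^esub> ?co (Suc k) ys zs)"
    using D fin(2) by (rule bmc_boundary_eq)
  also have "\<dots> = (\<Oplus>\<^bsub>K\<^esub>ys\<in>?S'. \<Oplus>\<^bsub>K\<^esub>xs\<in>?S. c xs \<otimes>\<^bsub>K\<^esub> (?co (Suc (Suc k)) xs ys \<otimes>\<^bsub>K\<^esub> ?co (Suc k) ys zs))"
    using cl fin by (intro finsum_cong')
      (auto intro!: finsum_closed simp: bmc_boundary_eq[OF c fin(1)] finsum_ldistr m_assoc)
  also have "\<dots> = (\<Oplus>\<^bsub>K\<^esub>xs\<in>?S. \<Oplus>\<^bsub>K\<^esub>ys\<in>?S'. c xs \<otimes>\<^bsub>K\<^esub> (?co (Suc (Suc k)) xs ys \<otimes>\<^bsub>K\<^esub> ?co (Suc k) ys zs))"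
    using cl fin by (intro finsum_swap) auto
  also have "\<dots> = \<zero>\<^bsub>K\<^esub>"
  proof (rule add.finprod_one_eqI)
    fix xs
    assume xs: "xs \<in> ?S"
    have "(\<Oplus>\<^bsub>K\<^esub>ys\<in>?S'. c xs \<otimes>\<^bsub>K\<^esub> (?co (Suc (Suc k)) xs ys \<otimes>\<^bsub>K\<^esub> ?co (Suc k) ys zs))
        = c xs \<otimes>\<^bsub>K\<^esub> (\<Oplus>\<^bsub>K\<^esub>ys\<in>?S'. ?co (Suc (Suc k)) xs ys \<otimes>\<^bsub>K\<^esub> ?co (Suc k) ys zs)"
      using cl fin by (intro finsum_rdistr[symmetric]) auto
    also have "(\<Oplus>\<^bsub>K\<^esub>ys\<in>?S'. ?co (Suc (Suc k)) xs ys \<otimes>\<^bsub>K\<^esub> ?co (Suc k) ys zs) = \<zero>\<^bsub>K\<^esub>"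
      using fin(2) face_in_bmc_generators[OF xs] xs
      by (intro bmc_coeff_bmc_coeff) (auto simp: bmc_generators_def)
    finally show "(\<Oplus>\<^bsub>K\<^esub>ys\<in>?S'. c xs \<otimes>\<^bsub>K\<^esub> (?co (Suc (Suc k)) xs ys \<otimes>\<^bsub>K\<^esub> ?co (Suc k) ys zs)) = \<zero>\<^bsub>K\<^esub>"
      using cl by simp
  qed
  finally show "bmc_boundary K (Suc k) l ?D zs = \<zero>\<^bsub>K\<^esub>" .
qed

section \<open>Dimensions of cycles, boundaries and homology\<close>

lemma module_hom_submodules:
  assumes "vectorspace K V" "vectorspace K W" "T \<in> module_hom K V W"
  shows "submodule K {v \<in> carrier V. T v = \<zero>\<^bsub>W\<^esub>} V" and "submodule K (T ` carrier V) W"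
proof -
  interpret V: vectorspace K V by fact
  interpret W: vectorspace K W by fact
  interpret mod_hom K V W T
    by (intro mod_hom.intro mod_hom_axioms.intro assms) (rule V.module_axioms W.module_axioms)+
  show "submodule K {v \<in> carrier V. T v = \<zero>\<^bsub>W\<^esub>} V"
    using ker_is_submodule unfolding ker_def .
  show "submodule K (T ` carrier V) W"
    using im_is_submodule unfolding im_def .
qed

lemma submodule_nested:
  assumes N: "submodule K N V" and U: "submodule K U V" and "N \<subseteq> U"
  shows "submodule K N (V\<lparr>carrier := U\<rparr>)"
proof -
  have "module K (V\<lparr>carrier := U\<rparr>)"
    using module.submodule_is_module[OF submodule.module[OF U] U] .
  then show ?thesis
    using N \<open>N \<subseteq> U\<close> unfolding submodule_def by simp
qed

text \<open>\<open>r k\<close> is the rank of the boundary out of degree \<open>Suc k\<close>, which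
  is why rank-nullity in degree \<open>Suc k\<close> pairs \<open>z (Suc k)\<close> with
  \<open>r k\<close>. In degree 0 every chain is a cycle. The bars alive at \<open>l\<close> count
  the dimension of cycles modulo boundaries.\<close>

lemma bmc_cycles_dim:
  fixes K :: "('c, 'r) ring_scheme"
  assumes "field K" "Metric_space X d" "finite X"
  defines "C \<equiv> BMC K X d" and "D \<equiv> bmc_boundary K"
  defines "r \<equiv> \<lambda>k l. vectorspace.dim K (space_at (C k) l\<lparr>carrier := boundaries C D k l\<rparr>)"
    and "z \<equiv> \<lambda>k l. vectorspace.dim K (space_at (C k) l\<lparr>carrier := cycles C D k l\<rparr>)"
  shows "z 0 l = card (bmc_generators X d 0 l)"
    and "z (Suc k) l + r k l = card (bmc_generators X d (Suc k) l)"
    and "has_barcode K (BMH K X d k) I a b \<Longrightarrow> finite I \<Longrightarrow>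
      card {i \<in> I. a i \<le> l \<and> ereal l < b i} + r k l = z k l"
proof -
  let ?F = "\<lambda>k. free_module K (bmc_generators X d k l)"
  have vs: "vectorspace K (?F k)" and fd: "vectorspace.fin_dim K (?F k)"
    and dim: "vectorspace.dim K (?F k) = card (bmc_generators X d k l)" for k
    using assms(1) finite_bmc_generators[OF assms(3)] by (auto intro: free_module_vectorspace free_module_dim)
  have D: "D (Suc k) l \<in> module_hom K (?F (Suc k)) (?F k)" for k
    unfolding D_def using assms(1-3) by (rule bmc_boundary_hom)
  have Z0: "cycles C D 0 l = carrier (?F 0)"
    by (simp add: cycles_def C_def)
  have ZSuc: "cycles C D (Suc k) l = {v \<in> carrier (?F (Suc k)). D (Suc k) l v = \<zero>\<^bsub>?F k\<^esub>}" for k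
    by (simp add: cycles_def C_def)
  have B: "boundaries C D k l = D (Suc k) l ` carrier (?F (Suc k))" for k
    by (simp add: boundaries_def C_def)
  show "z 0 l = card (bmc_generators X d 0 l)"
    using dim[of 0] by (simp add: z_def C_def Z0[unfolded C_def])
  show "z (Suc k) l + r k l = card (bmc_generators X d (Suc k) l)"
    using vectorspace_rank_nullity[OF vs fd vs D, of k] dim[of "Suc k"]
    unfolding z_def r_def ZSuc B by (simp add: C_def)
  show "card {i \<in> I. a i \<le> l \<and> ereal l < b i} + r k l = z k l"
    if bar: "has_barcode K (BMH K X d k) I a b" and I: "finite I"
  proof -
    have Z: "submodule K (cycles C D k l) (?F k)"
    proof (cases k)
      case 0
      interpret V: vectorspace K "?F 0"
        by (rule vs)
      show ?thesis
        unfolding 0 Z0 by (rule submodule.intro) (rule V.module_axioms, auto simp del: free_module_simps)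
    next
      case (Suc k')
      then show ?thesis
        unfolding Suc ZSuc using module_hom_submodules(1)[OF vs vs D] by simp
    qed
    have "boundaries C D k l \<subseteq> cycles C D k l"
    proof (cases k)
      case 0
      then show ?thesis
        unfolding 0 Z0 B using D[of 0] unfolding module_hom_def by blast
    next
      case (Suc k')
      then show ?thesis
        unfolding Suc ZSuc B using D[of "Suc k'"] bmc_boundary_bmc_boundary[OF assms(1-3)]
        unfolding module_hom_def D_def by auto
    qed
    then have N: "submodule K (boundaries C D k l) (?F k\<lparr>carrier := cycles C D k l\<rparr>)"
      using Z module_hom_submodules(2)[OF vs vs D] unfolding B by (intro submodule_nested) auto
    have sub: "subspace K (cycles C D k l) (?F k)"
      using vs Z by (rule subspace.intro)
    have "space_at (BMH K X d k) l
        = quotient_module (?F k\<lparr>carrier := cycles C D k l\<rparr>) (boundaries C D k l)"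
      by (simp add: BMH_def homology_def C_def D_def)
    from barcode_dim[OF assms(1) I bar this vectorspace.subspace_is_vs[OF vs sub]
        vectorspace.subspace_fin_dim[OF vs fd sub] N]
    show ?thesis
      by (simp add: r_def z_def C_def)
  qed
qed

text \<open>Here \<open>h\<close> and \<open>g\<close> stand for the dimensions of homology and
  chains, and \<open>r\<close> for the ranks of the boundaries into each degree. Every rank occurs
  in two consecutive degrees with opposite signs, so telescoping leaves only \<open>r n\<close>,
  which is at most \<open>g n\<close>.\<close>

lemma alternating_sum_telescope:
  fixes h g r :: "nat \<Rightarrow> nat"
  assumes "h 0 + r 0 = g 0" "\<And>k. h (Suc k) + r (Suc k) + r k = g (Suc k)"
  shows "\<bar>(\<Sum>k\<le>n. (-1) ^ k * real (h k)) - (\<Sum>k\<le>n. (-1) ^ k * real (g k))\<bar> \<le> real (g n)"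
proof -
  have "(\<Sum>k\<le>n. (-1) ^ k * real (h k)) - (\<Sum>k\<le>n. (-1) ^ k * real (g k)) = - ((-1) ^ n * real (r n))"
  proof (induction n)
    case 0
    then show ?case using assms(1) by (simp flip: assms(1))
  next
    case (Suc n)
    then show ?case by (simp add: algebra_simps flip: assms(2))
  qed
  moreover have "r n \<le> g n"
    using assms(1) assms(2)[of "n - 1"] by (cases n) auto
  ultimately show ?thesis
    by (simp add: abs_mult power_abs)
qed

text \<open>Stopping at a fixed degree \<open>n\<close> gives one inequality that holds at every
  parameter \<open>l\<close>, in a form that can be integrated over \<open>l\<close>.\<close>

lemma bmh_euler_bound:
  fixes m :: "nat \<Rightarrow> nat"
  assumes "field K" "Metric_space X d" "finite X"
    and "\<And>k. has_barcode K (BMH K X d k) {1..m k} (a k) (b k)"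
  shows "\<bar>(\<Sum>k\<le>n. (-1) ^ k * real (card {i \<in> {1..m k}. a k i \<le> l \<and> ereal l < b k i}))
    - (\<Sum>k\<le>n. (-1) ^ k * real (card (bmc_generators X d k l)))\<bar> \<le> real (card (bmc_generators X d n l))"
proof (rule alternating_sum_telescope)
  note dims = bmc_cycles_dim(1,2)[OF assms(1-3), where l = l] and bars = bmc_cycles_dim(3)[OF assms(1-4) finite_atLeastAtMost]
  let ?r = "\<lambda>k. vectorspace.dim K (space_at (BMC K X d k) l
    \<lparr>carrier := boundaries (BMC K X d) (bmc_boundary K) k l\<rparr>)"
  show "card {i \<in> {1..m 0}. a 0 i \<le> l \<and> ereal l < b 0 i} + ?r 0 = card (bmc_generators X d 0 l)"
    using bars[of 0 l] dims(1) by simp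
  show "card {i \<in> {1..m (Suc k)}. a (Suc k) i \<le> l \<and> ereal l < b (Suc k) i} + ?r (Suc k) + ?r k
      = card (bmc_generators X d (Suc k) l)" for k
    using bars[of "Suc k" l] dims(2)[of k] by simp
qed

section \<open>Exponential sums over bars and tuples\<close>

lemma has_integral_exp_ray:
  fixes t p :: real
  assumes "t > 0"
  shows "((\<lambda>l. if p \<le> l then exp (- t * l) else 0) has_integral exp (- t * p) / t) UNIV"
proof -
  have "((\<lambda>l. if l \<in> {p..} then exp (- t * l) else 0) has_integral exp (- t * p) / t) UNIV"
    unfolding has_integral_restrict_UNIV by (rule has_integral_exp_minus_to_infinity[OF assms])
  then show ?thesis
    by (simp only: atLeast_iff)
qed

text \<open>A finite bar is the difference of two rays. An infinite bar is one ray, in agreement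
  with \<open>exp_ereal\<close> being 0 at minus infinity.\<close>

lemma has_integral_exp_bar:
  fixes t p :: real
  assumes "t > 0" "ereal p < q"
  shows "((\<lambda>l. if p \<le> l \<and> ereal l < q then exp (- t * l) else 0) has_integral
    (exp (- p * t) - exp_ereal (- q * ereal t)) / t) UNIV"
proof (cases q)
  case (real s)
  have "((\<lambda>l. (if p \<le> l then exp (- t * l) else 0) - (if s \<le> l then exp (- t * l) else 0))
      has_integral exp (- t * p) / t - exp (- t * s) / t) UNIV"
    using assms(1) by (intro has_integral_diff has_integral_exp_ray)
  moreover have "(\<lambda>l. (if p \<le> l then exp (- t * l) else 0) - (if s \<le> l then exp (- t * l) else 0))
      = (\<lambda>l. if p \<le> l \<and> ereal l < q then exp (- t * l) else 0)"
    using assms(2) by (auto simp: real fun_eq_iff)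
  ultimately show ?thesis
    by (simp add: real exp_ereal_def diff_divide_distrib mult.commute)
next
  case PInf
  then show ?thesis
    using has_integral_exp_ray[OF assms(1), of p] assms(1) by (simp add: exp_ereal_def mult.commute)
next
  case MInf
  then show ?thesis using assms(2) by simp
qed

text \<open>The weight \<open>exp (- t * l)\<close> is positive, so the pointwise bound passes to
  the integrals.\<close>

lemma exp_sum_diff_le:
  fixes H G E :: "real \<Rightarrow> real"
  assumes H: "((\<lambda>l. H l * exp (- t * l)) has_integral h) UNIV"
    and G: "((\<lambda>l. G l * exp (- t * l)) has_integral g) UNIV"
    and E: "((\<lambda>l. E l * exp (- t * l)) has_integral e) UNIV"
    and le: "\<And>l. \<bar>H l - G l\<bar> \<le> E l"
  shows "\<bar>h - g\<bar> \<le> e"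
proof -
  let ?D = "\<lambda>l. H l * exp (- t * l) - G l * exp (- t * l)"
  have D: "(?D has_integral h - g) UNIV"
    using H G by (rule has_integral_diff)
  have "norm (integral UNIV ?D) \<le> integral UNIV (\<lambda>l. E l * exp (- t * l))"
  proof (rule integral_norm_bound_integral)
    show "norm (?D l) \<le> E l * exp (- t * l)" for l
      using mult_right_mono[OF le[of l], of "exp (- t * l)"]
      by (simp add: abs_mult flip: left_diff_distrib)
  qed (use D E in blast)+
  then show ?thesis
    using integral_unique[OF D] integral_unique[OF E] by simp
qed

section \<open>Exponential sums of generators and bars\<close>

definition tuple_space :: "'a set \<Rightarrow> nat \<Rightarrow> 'a list set" where
  "tuple_space X k = {xs. length xs = Suc k \<and> set xs \<subseteq> X \<and> distinct_adj xs}"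

lemma finite_tuple_space: "finite X \<Longrightarrow> finite (tuple_space X k)"
  by (rule finite_subset[OF _ finite_lists_length_eq[of X "Suc k"]]) (auto simp: tuple_space_def)

text \<open>A tuple is a generator from the parameter equal to its length onwards, so each tuple
  contributes the integral over one ray.\<close>

lemma has_integral_card_generators:
  assumes "t > 0" "finite X"
  shows "((\<lambda>l. real (card (bmc_generators X d k l)) * exp (- t * l)) has_integral
    (\<Sum>xs\<in>tuple_space X k. exp (- t * tuple_length d xs)) / t) UNIV"
proof -
  have "((\<lambda>l. \<Sum>xs\<in>tuple_space X k. if tuple_length d xs \<le> l then exp (- t * l) else 0) has_integral
      (\<Sum>xs\<in>tuple_space X k. exp (- t * tuple_length d xs) / t)) UNIV"
    using assms by (intro has_integral_sum finite_tuple_space has_integral_exp_ray)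
  moreover have "{xs \<in> tuple_space X k. tuple_length d xs \<le> l} = bmc_generators X d k l" for l
    by (auto simp: tuple_space_def bmc_generators_def)
  ultimately show ?thesis
    by (simp add: sum.If_cases[OF finite_tuple_space[OF assms(2)]] sum_divide_distrib Collect_conj_eq[symmetric] Int_def)
qed

lemma has_integral_card_bars:
  fixes a :: "'i \<Rightarrow> real" and b :: "'i \<Rightarrow> ereal"
  assumes "t > 0" "finite I" "\<And>i. i \<in> I \<Longrightarrow> ereal (a i) < b i"
  shows "((\<lambda>l. real (card {i \<in> I. a i \<le> l \<and> ereal l < b i}) * exp (- t * l)) has_integral
    (\<Sum>i\<in>I. exp (- a i * t) - exp_ereal (- b i * ereal t)) / t) UNIV"
proof -
  have "((\<lambda>l. \<Sum>i\<in>I. if a i \<le> l \<and> ereal l < b i then exp (- t * l) else 0) has_integral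
      (\<Sum>i\<in>I. (exp (- a i * t) - exp_ereal (- b i * ereal t)) / t)) UNIV"
    using assms by (intro has_integral_sum has_integral_exp_bar)
  then show ?thesis
    by (simp add: sum.If_cases[OF assms(2)] sum_divide_distrib Int_def)
qed

text \<open>For \<open>x\<close> in \<open>X\<close> this is the entry at \<open>x\<close> of
  \<open>A ^ k\<close> applied to the all-ones vector, where \<open>A\<close> is the off-diagonal
  part of the matrix \<open>f\<close> on \<open>X\<close>.\<close>

primrec walk_sum :: "'a set \<Rightarrow> ('a \<Rightarrow> 'a \<Rightarrow> real) \<Rightarrow> nat \<Rightarrow> 'a \<Rightarrow> real" where
  "walk_sum X f 0 x = 1"
| "walk_sum X f (Suc k) x = (\<Sum>y\<in>X - {x}. f x y * walk_sum X f k y)"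

lemma tuple_space_Suc_hd:
  assumes "x \<in> X"
  shows "{xs \<in> tuple_space X (Suc k). hd xs = x}
    = (\<Union>y\<in>X - {x}. (#) x ` {xs \<in> tuple_space X k. hd xs = y})" (is "?L = ?R")
proof
  show "?R \<subseteq> ?L"
    using assms by (auto simp: tuple_space_def distinct_adj_Cons)
  show "?L \<subseteq> ?R"
  proof
    fix xs
    assume xs: "xs \<in> ?L"
    then obtain y ys where "xs = x # y # ys"
      unfolding tuple_space_def by (auto simp: length_Suc_conv)
    with xs have "y \<in> X - {x}" "xs \<in> (#) x ` {xs \<in> tuple_space X k. hd xs = y}"
      by (auto simp: tuple_space_def)
    then show "xs \<in> ?R"
      by blast
  qed
qed

text \<open>The exponential turns the length of a tuple into a product of step weights, and
  splitting off the first entry reproduces the recursion of \<open>walk_sum\<close>.\<close>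

lemma sum_tuple_space_hd:
  assumes "finite X" "x \<in> X"
  shows "(\<Sum>xs | xs \<in> tuple_space X k \<and> hd xs = x. exp (- t * tuple_length d xs))
    = walk_sum X (\<lambda>x y. exp (- (t * d x y))) k x"
  using assms(2)
proof (induction k arbitrary: x)
  case 0
  have "{xs \<in> tuple_space X 0. hd xs = x} = {[x]}"
    using 0 by (auto simp: tuple_space_def length_Suc_conv)
  then show ?case
    by (simp add: tuple_length_def)
next
  case (Suc k)
  let ?T = "\<lambda>k x. {xs \<in> tuple_space X k. hd xs = x}"
  have fin: "finite (?T k y)" for y
    using finite_tuple_space[OF assms(1)] by simp
  have "(\<Sum>xs\<in>?T (Suc k) x. exp (- t * tuple_length d xs))
      = (\<Sum>y\<in>X - {x}. \<Sum>xs\<in>(#) x ` ?T k y. exp (- t * tuple_length d xs))"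
    unfolding tuple_space_Suc_hd[OF Suc.prems] using assms(1) fin
    by (intro sum.UNION_disjoint) auto
  also have "\<dots> = (\<Sum>y\<in>X - {x}. \<Sum>xs\<in>?T k y. exp (- (t * d x y)) * exp (- t * tuple_length d xs))"
  proof (rule sum.cong[OF refl])
    fix y
    have "(\<Sum>xs\<in>(#) x ` ?T k y. exp (- t * tuple_length d xs))
        = (\<Sum>xs\<in>?T k y. exp (- t * tuple_length d (x # xs)))"
      by (subst sum.reindex) auto
    also have "\<dots> = (\<Sum>xs\<in>?T k y. exp (- (t * d x y)) * exp (- t * tuple_length d xs))"
    proof (rule sum.cong[OF refl])
      fix xs
      assume "xs \<in> ?T k y"
      then obtain ys where "xs = y # ys"
        by (cases xs) (auto simp: tuple_space_def)
      then show "exp (- t * tuple_length d (x # xs)) = exp (- (t * d x y)) * exp (- t * tuple_length d xs)"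
        by (simp add: tuple_length_def sum.lessThan_Suc_shift algebra_simps del: sum.lessThan_Suc flip: exp_add)
    qed
    finally show "(\<Sum>xs\<in>(#) x ` ?T k y. exp (- t * tuple_length d xs))
        = (\<Sum>xs\<in>?T k y. exp (- (t * d x y)) * exp (- t * tuple_length d xs))" .
  qed
  also have "\<dots> = (\<Sum>y\<in>X - {x}. exp (- (t * d x y)) * walk_sum X (\<lambda>x y. exp (- (t * d x y))) k y)"
    using Suc.IH by (simp add: sum_distrib_left[symmetric])
  finally show ?case by simp
qed

lemma sum_tuple_space:
  assumes "finite X"
  shows "(\<Sum>xs\<in>tuple_space X k. exp (- t * tuple_length d xs))
    = (\<Sum>x\<in>X. walk_sum X (\<lambda>x y. exp (- (t * d x y))) k x)"
proof -
  have "(\<Sum>x\<in>X. \<Sum>xs | xs \<in> tuple_space X k \<and> hd xs = x. exp (- t * tuple_length d xs))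
      = (\<Sum>xs\<in>tuple_space X k. exp (- t * tuple_length d xs))"
  proof (rule sum.group)
    show "hd ` tuple_space X k \<subseteq> X"
    proof
      fix x
      assume "x \<in> hd ` tuple_space X k"
      then obtain xs where "xs \<in> tuple_space X k" "x = hd xs" by auto
      then show "x \<in> X"
        by (cases xs) (auto simp: tuple_space_def)
    qed
  qed (use assms finite_tuple_space in auto)
  moreover have "(\<Sum>x\<in>X. \<Sum>xs | xs \<in> tuple_space X k \<and> hd xs = x. exp (- t * tuple_length d xs))
      = (\<Sum>x\<in>X. walk_sum X (\<lambda>x y. exp (- (t * d x y))) k x)"
    by (rule sum.cong[OF refl]) (rule sum_tuple_space_hd[OF assms])
  ultimately show ?thesis
    by (rule trans[OF sym])
qed

text \<open>The row sums bound the operator norm of the off-diagonal matrix for the maximum norm by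
  \<open>q\<close>, hence that of its \<open>k\<close>-th power by \<open>q ^ k\<close>.\<close>

lemma walk_sum_bounds:
  assumes "\<And>x y. 0 \<le> f x y" "\<And>x. x \<in> X \<Longrightarrow> (\<Sum>y\<in>X - {x}. f x y) \<le> q" "0 \<le> q" "x \<in> X"
  shows "0 \<le> walk_sum X f k x" and "walk_sum X f k x \<le> q ^ k"
proof -
  have "0 \<le> walk_sum X f k x \<and> walk_sum X f k x \<le> q ^ k"
    using assms(4)
  proof (induction k arbitrary: x)
    case (Suc k)
    have "(\<Sum>y\<in>X - {x}. f x y * walk_sum X f k y) \<le> (\<Sum>y\<in>X - {x}. f x y * q ^ k)"
      using Suc.IH assms(1) by (intro sum_mono mult_left_mono) auto
    also have "\<dots> \<le> q * q ^ k"
      unfolding sum_distrib_right[symmetric] using assms(2,3) Suc.prems by (intro mult_right_mono) auto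
    finally show ?case
      using Suc.IH assms(1) by (auto intro!: sum_nonneg)
  qed simp
  then show "0 \<le> walk_sum X f k x" "walk_sum X f k x \<le> q ^ k" by auto
qed

section \<open>Magnitude as an alternating series of walk sums\<close>

lemma has_magnitudeI:
  assumes w: "weighting X d w" and sym: "\<And>x y. x \<in> X \<Longrightarrow> y \<in> X \<Longrightarrow> d x y = d y x"
  shows "has_magnitude X d" and "magnitude X d = (\<Sum>x\<in>X. w x)"
proof -
  show "has_magnitude X d"
    using w by (auto simp: has_magnitude_def)
  \<comment> \<open>Both totals equal the double sum of \<open>w' x * exp (- d x y) * w y\<close>,
    evaluated by rows or by columns; this is where symmetry enters.\<close>
  have "(\<Sum>x\<in>X. w' x) = (\<Sum>x\<in>X. w x)" if w': "weighting X d w'" for w'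
  proof -
    have "(\<Sum>x\<in>X. w' x) = (\<Sum>x\<in>X. w' x * (\<Sum>y\<in>X. exp (- d x y) * w y))"
      using w by (simp add: weighting_def)
    also have "\<dots> = (\<Sum>x\<in>X. \<Sum>y\<in>X. w y * (exp (- d y x) * w' x))"
      using sym by (auto simp: sum_distrib_left intro!: sum.cong)
    also have "\<dots> = (\<Sum>y\<in>X. w y * (\<Sum>x\<in>X. exp (- d y x) * w' x))"
      unfolding sum_distrib_left by (rule sum.swap)
    also have "\<dots> = (\<Sum>y\<in>X. w y)"
      using w' by (simp add: weighting_def)
    finally show ?thesis .
  qed
  note unique = this
  show "magnitude X d = (\<Sum>x\<in>X. w x)"
    unfolding magnitude_def
  proof (rule the_equality)
    show "\<exists>w'. weighting X d w' \<and> (\<Sum>x\<in>X. w x) = (\<Sum>x\<in>X. w' x)"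
      using w by (intro exI conjI) (assumption, rule refl)
  next
    fix s
    assume "\<exists>w'. weighting X d w' \<and> s = (\<Sum>x\<in>X. w' x)"
    then show "s = (\<Sum>x\<in>X. w x)"
      using unique by (elim exE conjE) (simp only:)
  qed
qed

text \<open>Let \<open>A\<close> be the off-diagonal part of the matrix
  \<open>exp (- d x y)\<close>, whose diagonal is 1. The alternating series of the vectors
  \<open>u k\<close>, which are \<open>A ^ k\<close> applied to the all-ones vector, converges
  because the row sums of \<open>A\<close> are at most \<open>q < 1\<close>. Its sum
  \<open>w\<close> solves \<open>(1 + A) w = 1\<close>, so it is a weighting.\<close>

lemma magnitude_walk_sums:
  assumes "Metric_space X d" "finite X"
    and q: "\<And>x. x \<in> X \<Longrightarrow> (\<Sum>y\<in>X - {x}. exp (- d x y)) \<le> q" "0 \<le> q" "q < 1"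
  defines "u \<equiv> walk_sum X (\<lambda>x y. exp (- d x y))"
  shows "has_magnitude X d" and "(\<lambda>k. (-1) ^ k * (\<Sum>x\<in>X. u k x)) sums magnitude X d"
    and "(\<lambda>k. \<Sum>x\<in>X. u k x) \<longlonglongrightarrow> 0"
proof -
  interpret Metric_space X d by fact
  have bounds: "0 \<le> u k x" "u k x \<le> q ^ k" if "x \<in> X" for k x
    unfolding u_def by (rule walk_sum_bounds[OF _ q(1,2) that]; simp)+
  have "(\<lambda>k. u k x) \<longlonglongrightarrow> 0" if "x \<in> X" for x
  proof (rule real_tendsto_sandwich[OF always_eventually always_eventually tendsto_const])
    show "(\<lambda>k. q ^ k) \<longlonglongrightarrow> 0"
      using q(2,3) by (intro LIMSEQ_power_zero) simp
  qed (simp_all add: bounds that)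
  then show "(\<lambda>k. \<Sum>x\<in>X. u k x) \<longlonglongrightarrow> 0"
    using tendsto_sum[of X "\<lambda>x k. u k x" "\<lambda>_. 0" sequentially] by simp
  define w where "w x = (\<Sum>k. (-1) ^ k * u k x)" for x
  have w: "(\<lambda>k. (-1) ^ k * u k x) sums w x" if "x \<in> X" for x
  proof -
    have "summable (\<lambda>k. (-1) ^ k * u k x)"
      by (rule summable_comparison_test[of _ "\<lambda>k. q ^ k"])
         (use q(2,3) in \<open>simp_all add: bounds that abs_mult power_abs summable_geometric\<close>)
    then show ?thesis
      unfolding w_def by (rule summable_sums)
  qed
  have weighting: "weighting X d w"
    unfolding weighting_def
  proof
    fix x
    assume x: "x \<in> X"
    have "(\<lambda>k. \<Sum>y\<in>X - {x}. exp (- d x y) * ((-1) ^ k * u k y)) sums (\<Sum>y\<in>X - {x}. exp (- d x y) * w y)"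
      using w by (intro sums_sum sums_mult) auto
    \<comment> \<open>Applying \<open>A\<close> to a term gives the next term with the opposite
      sign. Hence \<open>A w\<close> is minus the series without its degree 0 term, which is
      1.\<close>
    moreover have "(\<Sum>y\<in>X - {x}. exp (- d x y) * ((-1) ^ k * u k y)) = - ((-1) ^ Suc k * u (Suc k) x)" for k
      by (simp add: u_def sum_distrib_left mult.left_commute sum_negf)
    ultimately have "(\<lambda>k. - ((-1) ^ Suc k * u (Suc k) x)) sums (\<Sum>y\<in>X - {x}. exp (- d x y) * w y)"
      by (simp only:)
    moreover have "(\<lambda>k. - ((-1) ^ Suc k * u (Suc k) x)) sums - (w x - 1)"
      using sums_Suc_iff[of "\<lambda>k. (-1) ^ k * u k x" "w x - 1"] w[OF x]
      by (intro sums_minus) (simp add: u_def)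
    ultimately have "(\<Sum>y\<in>X - {x}. exp (- d x y) * w y) = - (w x - 1)"
      by (rule sums_unique2)
    \<comment> \<open>The term at \<open>y = x\<close> is \<open>w x\<close>, because
      \<open>d x x = 0\<close>.\<close>
    then show "(\<Sum>y\<in>X. exp (- d x y) * w y) = 1"
      using x assms(2) by (subst sum.remove[of X x]) auto
  qed
  note mag = has_magnitudeI[OF weighting commute]
  show "has_magnitude X d"
    by (rule mag)
  have "(\<lambda>k. \<Sum>x\<in>X. (-1) ^ k * u k x) sums (\<Sum>x\<in>X. w x)"
    using w by (intro sums_sum)
  then show "(\<lambda>k. (-1) ^ k * (\<Sum>x\<in>X. u k x)) sums magnitude X d"
    by (simp add: mag(2) sum_distrib_left)
qed

text \<open>Distances between distinct points are positive, so each of the finitely many summands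
  tends to 0.\<close>

lemma eventually_exp_row_sum_le:
  assumes "Metric_space X d" "finite X" "q > 0"
  shows "\<forall>\<^sub>F t in at_top. \<forall>x\<in>X. (\<Sum>y\<in>X - {x}. exp (- (t * d x y))) \<le> q"
proof (rule eventually_ball_finite[OF assms(2)], rule ballI)
  interpret Metric_space X d by fact
  fix x
  assume x: "x \<in> X"
  have "((\<lambda>t. \<Sum>y\<in>X - {x}. exp (- (t * d x y))) \<longlongrightarrow> (\<Sum>y\<in>X - {x}. 0)) at_top"
  proof (intro tendsto_sum)
    fix y
    assume "y \<in> X - {x}"
    then have "d x y > 0"
      using x by (auto simp: mdist_pos_eq)
    then have "filterlim (\<lambda>t. t * d x y) at_top at_top"
      by (intro filterlim_at_top_mult_tendsto_pos[OF tendsto_const] filterlim_ident)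
    then show "((\<lambda>t. exp (- (t * d x y))) \<longlongrightarrow> 0) at_top"
      by (intro filterlim_compose[OF exp_at_bot]) (simp add: filterlim_uminus_at_bot)
  qed
  then have "((\<lambda>t. \<Sum>y\<in>X - {x}. exp (- (t * d x y))) \<longlongrightarrow> 0) at_top"
    by simp
  then have "\<forall>\<^sub>F t in at_top. (\<Sum>y\<in>X - {x}. exp (- (t * d x y))) < q"
    using assms(3) by (rule order_tendstoD(2))
  then show "\<forall>\<^sub>F t in at_top. (\<Sum>y\<in>X - {x}. exp (- (t * d x y))) \<le> q"
    by eventually_elim simp
qed

section \<open>Comparison of bar sums with tuple sums\<close>

lemma bmh_exp_sum_bound:
  fixes m :: "nat \<Rightarrow> nat" and a :: "nat \<Rightarrow> nat \<Rightarrow> real" and b :: "nat \<Rightarrow> nat \<Rightarrow> ereal"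
  assumes "field K" "Metric_space X d" "finite X" "t > 0"
    and bar: "\<And>k. has_barcode K (BMH K X d k) {1..m k} (a k) (b k)"
  defines "T \<equiv> \<lambda>k. \<Sum>xs\<in>tuple_space X k. exp (- t * tuple_length d xs)"
  shows "\<bar>(\<Sum>k\<le>n. \<Sum>i = 1..m k. (-1) ^ k * (exp (- a k i * t) - exp_ereal (- b k i * ereal t)))
    - (\<Sum>k\<le>n. (-1) ^ k * T k)\<bar> \<le> T n"
proof -
  let ?e = "\<lambda>k i. exp (- a k i * t) - exp_ereal (- b k i * ereal t)"
  let ?h = "\<lambda>k l. real (card {i \<in> {1..m k}. a k i \<le> l \<and> ereal l < b k i})"
  let ?g = "\<lambda>k l. real (card (bmc_generators X d k l))"
  have "((\<lambda>l. \<Sum>k\<le>n. (-1) ^ k * (?h k l * exp (- t * l))) has_integral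
      (\<Sum>k\<le>n. (-1) ^ k * ((\<Sum>i = 1..m k. ?e k i) / t))) UNIV"
    using bar assms(4)
    by (intro has_integral_sum has_integral_mult_right has_integral_card_bars) (auto simp: has_barcode_def)
  moreover have "((\<lambda>l. \<Sum>k\<le>n. (-1) ^ k * (?g k l * exp (- t * l))) has_integral
      (\<Sum>k\<le>n. (-1) ^ k * (T k / t))) UNIV"
    unfolding T_def using assms(3,4)
    by (intro has_integral_sum has_integral_mult_right has_integral_card_generators) auto
  moreover have "((\<lambda>l. ?g n l * exp (- t * l)) has_integral T n / t) UNIV"
    unfolding T_def using assms(3,4) by (intro has_integral_card_generators)
  moreover have "\<bar>(\<Sum>k\<le>n. (-1) ^ k * ?h k l) - (\<Sum>k\<le>n. (-1) ^ k * ?g k l)\<bar> \<le> ?g n l" for l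
    using assms(1-3) bar by (rule bmh_euler_bound)
  \<comment> \<open>The integrands are rewritten as a function of \<open>l\<close> times
    \<open>exp (- t * l)\<close>, so that the Euler characteristic bound at each \<open>l\<close>
    can be integrated. The common factor \<open>1 / t\<close> is removed afterwards.\<close>
  ultimately have "\<bar>(\<Sum>k\<le>n. (-1) ^ k * ((\<Sum>i = 1..m k. ?e k i) / t)) - (\<Sum>k\<le>n. (-1) ^ k * (T k / t))\<bar>
      \<le> T n / t"
    unfolding mult.assoc[symmetric] sum_distrib_right[symmetric] by (rule exp_sum_diff_le)
  moreover have "(\<Sum>k\<le>n. (-1) ^ k * ((\<Sum>i = 1..m k. ?e k i) / t)) = (\<Sum>k\<le>n. \<Sum>i = 1..m k. (-1) ^ k * ?e k i) / t"
    by (simp only: sum_distrib_left sum_divide_distrib times_divide_eq_right)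
  moreover have "(\<Sum>k\<le>n. (-1) ^ k * (T k / t)) = (\<Sum>k\<le>n. (-1) ^ k * T k) / t"
    by (simp only: sum_divide_distrib times_divide_eq_right)
  ultimately have "\<bar>(\<Sum>k\<le>n. \<Sum>i = 1..m k. (-1) ^ k * ?e k i) - (\<Sum>k\<le>n. (-1) ^ k * T k)\<bar> / t \<le> T n / t"
    using assms(4) by (simp only: diff_divide_distrib[symmetric] abs_divide abs_of_pos)
  then show ?thesis
    using assms(4) by (simp add: divide_le_cancel)
qed

theorem theorem4p9:
  fixes K :: "('c, 'r) ring_scheme"
    and X :: "'a set" and d :: "'a \<Rightarrow> 'a \<Rightarrow> real"
    and m :: "nat \<Rightarrow> nat" and a :: "nat \<Rightarrow> nat \<Rightarrow> real" and b :: "nat \<Rightarrow> nat \<Rightarrow> ereal"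
  assumes "field K"
    and "Metric_space X d" and "finite X"
    and "\<And>k. has_barcode K (BMH K X d k) {1..m k} (a k) (b k)"
  shows "\<forall>\<^sub>F t in at_top.
    has_magnitude X (scale_metric t d) \<and>
    (\<lambda>k. \<Sum>i = 1..m k. (-1) ^ k * (exp (- a k i * t) - exp_ereal (- b k i * ereal t)))
      sums magnitude X (scale_metric t d)"
proof -
  \<comment> \<open>Any positive bound below 1 would do in place of \<open>1 / 2\<close>: it makes
    the Neumann series converge.\<close>
  have "\<forall>\<^sub>F t in at_top. \<forall>x\<in>X. (\<Sum>y\<in>X - {x}. exp (- (t * d x y))) \<le> 1 / 2"
    using assms(2,3) by (rule eventually_exp_row_sum_le) simp
  with eventually_gt_at_top[of 0] show ?thesis
  proof eventually_elim
    case (elim t)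
    interpret Metric_space X d by fact
    interpret tX: Metric_space X "scale_metric t d"
    proof
      fix x y z
      assume "x \<in> X" "y \<in> X" "z \<in> X"
      then show "scale_metric t d x z \<le> scale_metric t d x y + scale_metric t d y z"
        using elim(1) triangle[of x y z] by (simp add: scale_metric_def flip: distrib_left)
    qed (use elim(1) in \<open>auto simp: scale_metric_def commute\<close>)
    define T where "T k = (\<Sum>xs\<in>tuple_space X k. exp (- t * tuple_length d xs))" for k
    have T: "T k = (\<Sum>x\<in>X. walk_sum X (\<lambda>x y. exp (- scale_metric t d x y)) k x)" for k
      unfolding T_def scale_metric_def using assms(3) by (rule sum_tuple_space)
    have row: "(\<Sum>y\<in>X - {x}. exp (- scale_metric t d x y)) \<le> 1 / 2" if "x \<in> X" for x
      using elim(2) that by (simp add: scale_metric_def)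
    note mag = magnitude_walk_sums[OF tX.Metric_space_axioms assms(3) row, folded T]
    let ?f = "\<lambda>k. \<Sum>i = 1..m k. (-1) ^ k * (exp (- a k i * t) - exp_ereal (- b k i * ereal t))"
    \<comment> \<open>The partial sums over bars and over tuples differ by at most
      \<open>T n\<close>, which tends to 0. Convergence of the series over bars thus follows from
      that of the series over tuples.\<close>
    have "(\<lambda>n. (\<Sum>k\<le>n. ?f k) - (\<Sum>k\<le>n. (-1) ^ k * T k)) \<longlonglongrightarrow> 0"
    proof (rule Lim_null_comparison)
      show "\<forall>\<^sub>F n in sequentially. norm ((\<Sum>k\<le>n. ?f k) - (\<Sum>k\<le>n. (-1) ^ k * T k)) \<le> T n"
        unfolding T_def real_norm_def
        by (intro always_eventually allI bmh_exp_sum_bound[OF assms(1-3) elim(1) assms(4)])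
      show "T \<longlonglongrightarrow> 0"
        using mag(3) by simp
    qed
    moreover have "(\<lambda>n. \<Sum>k\<le>n. (-1) ^ k * T k) \<longlonglongrightarrow> magnitude X (scale_metric t d)"
      using mag(2) by (simp add: sums_def_le)
    ultimately have "(\<lambda>n. \<Sum>k\<le>n. ?f k) \<longlonglongrightarrow> magnitude X (scale_metric t d)"
      using Lim_transform by fast
    then show ?case
      using mag(1) by (simp add: sums_def_le)
  qed
qed

end
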